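(* Let $k$ be an algebraically closed field of characteristic $2$ and let $m\ge 1$. Then $$\{Q^{(j)},\ \mathrm{Tr}^{(i_1,\dots,i_s)}\mid 1\le j\le m;\ 2\le s\le m;\ 1\le i_1<\cdots<i_s\le m\}$$ is a minimal system of generators of the $k$-algebra $R_{3\times m}^{O(3)}$.
   Context: $k$ is an algebraically closed field of characteristic $2$. $O(3)$ is the group of linear automorphisms of $k^3$ (coordinates $x,y,z$) preserving the quadratic form $q=xy+z^2$. $R_{3\times m}=k[x^{(i)},y^{(i)},z^{(i)}:1\le i\le m]$ is the algebra of polynomials in the coordinates of $m$ indeterminate vectors $v^{(i)}=(x^{(i)},y^{(i)},z^{(i)})$, with $O(3)$ acting diagonally; $R_{3\times m}^{O(3)}$ is the subalgebra of invariants. $Q^{(j)}=q(v^{(j)})=x^{(j)}y^{(j)}+(z^{(j)})^2$. To $v^{(i)}$ associate the $2\times 2$ matrix $V^{(i)}=\begin{pmatrix} z^{(i)} & x^{(i)}\\ y^{(i)} & z^{(i)}\end{pmatrix}$, and define $\mathrm{Tr}^{(i_1,\dots,i_s)}=\mathrm{Tr}\left(V^{(i_1)}\cdots V^{(i_s)}\right)$, the trace of the matrix product. These are elements of $R_{3\times m}^{O(3)}$. *)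

theory Defs
  imports
    "HOL-Analysis.Determinants"
    "HOL-Library.Poly_Mapping"
    "HOL-Computational_Algebra.Polynomial"
begin

section \<open>The coordinate ring of \<open>m\<close> vectors\<close>

text \<open>
  Polynomials over \<open>'a\<close> in the variables \<open>(i, c)\<close>: the pairs \<open>(i, 1)\<close>, \<open>(i, 2)\<close>, \<open>(i, 3)\<close> are the
  coordinates \<open>x\<close>, \<open>y\<close>, \<open>z\<close> of the \<open>i\<close>-th vector. A monomial is a finitely supported exponent
  function, and the library's product on \<^typ>\<open>'b \<Rightarrow>\<^sub>0 'a\<close> is convolution, hence polynomial
  multiplication. Here \<open>3\<close> is the type with three elements, in which \<open>3 = 0\<close>.
\<close>

type_synonym 'a vpoly = "(nat \<times> 3 \<Rightarrow>\<^sub>0 nat) \<Rightarrow>\<^sub>0 'a"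

definition Const :: "'a::comm_ring_1 \<Rightarrow> 'a vpoly" where
  "Const a = Poly_Mapping.single 0 a"

definition Var :: "nat \<times> 3 \<Rightarrow> 'a::comm_ring_1 vpoly" where
  "Var u = Poly_Mapping.single (Poly_Mapping.single u 1) 1"

definition R3 :: "nat \<Rightarrow> 'a::comm_ring_1 vpoly set" where
  "R3 m = {f. \<forall>t \<in> Poly_Mapping.keys f. Poly_Mapping.keys t \<subseteq> {1..m} \<times> UNIV}"

definition vsubst :: "(nat \<times> 3 \<Rightarrow> 'a vpoly) \<Rightarrow> 'a::comm_ring_1 vpoly \<Rightarrow> 'a vpoly" where
  "vsubst \<sigma> f = (\<Sum>t \<in> Poly_Mapping.keys f. Const (Poly_Mapping.lookup f t) * (\<Prod>u \<in> Poly_Mapping.keys t. \<sigma> u ^ Poly_Mapping.lookup t u))"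


section \<open>The orthogonal group and its invariants\<close>

definition qform :: "'a::comm_ring_1 ^ 3 \<Rightarrow> 'a" where
  "qform v = v $ 1 * v $ 2 + (v $ 3)\<^sup>2"

text \<open>Linear automorphisms of \<open>k\<^sup>3\<close> are represented by their invertible matrices.\<close>

definition O3 :: "('a::field ^ 3 ^ 3) set" where
  "O3 = {A. invertible A \<and> (\<forall>v. qform (A *v v) = qform v)}"

text \<open>
  The action on polynomials is by pullback,
  \<open>(v\<^sub>1, \<dots>, v\<^sub>m) \<mapsto> f (A v\<^sub>1, \<dots>, A v\<^sub>m)\<close>. This is a right action; the corresponding left
  action, by the inverse of \<open>A\<close>, has the same invariants.
\<close>

definition pullback :: "'a::comm_ring_1 ^ 3 ^ 3 \<Rightarrow> 'a vpoly \<Rightarrow> 'a vpoly" where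
  "pullback A = vsubst (\<lambda>(i, c). \<Sum>d\<in>UNIV. Const (A $ c $ d) * Var (i, d))"

definition O3_invariants :: "nat \<Rightarrow> 'a::field vpoly set" where
  "O3_invariants m = {f \<in> R3 m. \<forall>A \<in> O3. pullback A f = f}"


section \<open>Generators of subalgebras\<close>

definition subalgebra :: "'a::comm_ring_1 vpoly set \<Rightarrow> bool" where
  "subalgebra S \<longleftrightarrow>
     range Const \<subseteq> S \<and> (\<forall>f \<in> S. \<forall>g \<in> S. f + g \<in> S) \<and> (\<forall>f \<in> S. \<forall>g \<in> S. f * g \<in> S)"

definition minimal_generating_set :: "'a::comm_ring_1 vpoly set \<Rightarrow> 'a vpoly set \<Rightarrow> bool" where
  "minimal_generating_set G S \<longleftrightarrow>
     subalgebra hull G = S \<and> (\<forall>H. H \<subset> G \<longrightarrow> subalgebra hull H \<noteq> S)"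


section \<open>The invariants \<open>Q\<close> and \<open>Tr\<close>\<close>

definition gvec :: "nat \<Rightarrow> 'a::comm_ring_1 vpoly ^ 3" where
  "gvec i = (\<chi> c. Var (i, c))"

definition Q :: "nat \<Rightarrow> 'a::comm_ring_1 vpoly" where
  "Q j = qform (gvec j)"

definition Vmat :: "nat \<Rightarrow> 'a::comm_ring_1 vpoly ^ 2 ^ 2" where
  "Vmat i = vector [vector [gvec i $ 3, gvec i $ 1],
                    vector [gvec i $ 2, gvec i $ 3]]"

definition Tr :: "nat list \<Rightarrow> 'a::comm_ring_1 vpoly" where
  "Tr is = trace (foldr (\<lambda>i M. Vmat i ** M) is (mat 1))"

end

theory Submission
  imports Defs
begin

text \<open>
  In characteristic \<open>2\<close> the matrices \<open>V = (z, x; y, z)\<close> are exactly the \<open>2 \<times> 2\<close> matrices of trace \<open>0\<close>, and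
  \<open>q = x y + z\<^sup>2\<close> is their determinant. Since \<open>k\<close> contains all square roots, every element of \<open>O(3)\<close> is
  conjugation by an element of \<open>SL\<^sub>2(k)\<close> (\<open>O3_conjugation\<close>), so traces of products of the \<open>V\<close> are
  invariant. Three ideas show that there is nothing else.

  First, on the locus where all \<open>q(v\<^sub>i)\<close> vanish, \<open>v\<^sub>i = (a\<^sub>i\<^sup>2, b\<^sub>i\<^sup>2, a\<^sub>i b\<^sub>i)\<close> is the square of a vector
  \<open>(a\<^sub>i, b\<^sub>i)\<close> of the plane, and \<open>V\<^sub>i\<close> has rank one. An \<open>O(3)\<close>-invariant restricts to an
  \<open>SL\<^sub>2\<close>-invariant of the plane vectors which has even degree in each of them. By the first fundamental
  theorem for \<open>SL\<^sub>2\<close> (\<open>covariants_bracket_span\<close>, valid over any infinite field) it is a combination of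
  products of brackets \<open>[i j] = a\<^sub>i b\<^sub>j - a\<^sub>j b\<^sub>i\<close>. Such a product is a multigraph on the vectors; all its
  vertices have even degree, so it decomposes into closed walks, and the product of brackets along a
  closed walk is the trace of the corresponding product of rank one matrices (\<open>trace_cone\<close>,
  \<open>even_bracket_monomial_walk\<close>).

  Secondly, the conditions \<open>q(v\<^sub>i) = 0\<close> are released one at a time (\<open>restriction_onto_step\<close>): an invariant
  and its approximation by generators differ by a function that vanishes where \<open>q(v\<^sub>i) = 0\<close>, hence by
  \<open>q(v\<^sub>i)\<close> times an invariant whose degree in \<open>v\<^sub>i\<close> is smaller by \<open>2\<close>.

  Thirdly, the matrices satisfy the Clifford relations \<open>V\<^sub>i\<^sup>2 = q(v\<^sub>i)\<close> and
  \<open>V\<^sub>i V\<^sub>j + V\<^sub>j V\<^sub>i = Tr(V\<^sub>i V\<^sub>j)\<close>, so the trace of an arbitrary word reduces to traces of strictly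
  increasing words (\<open>generated_trace\<close>).

  The system is minimal because each generator has a monomial that the others cannot produce. Setting
  all vectors but \<open>v\<^sub>j\<close> to zero kills everything except \<open>Q\<^sup>(\<^sup>j\<^sup>)\<close> (\<open>Q_indecomposable\<close>). The trace of the
  word \<open>a, b, c\<^sub>1, \<dots>, c\<^sub>r\<close> contains \<open>x\<^sub>a y\<^sub>b z\<^sub>c\<^sub>1 \<cdots> z\<^sub>c\<^sub>r\<close>, while every monomial of every trace contains
  some \<open>x\<close>, so that a product of two traces has degree at least two in the \<open>x\<close>; and the \<open>Q\<^sup>(\<^sup>i\<^sup>)\<close> do
  not help, since they have degree two in a single vector (\<open>Tr_indecomposable\<close>).

  Because \<open>k\<close> is infinite, a polynomial is determined by its values (\<open>ev_inject\<close>), and most of the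
  proof is about polynomial functions: there the group acts by composition, and divisibility and
  homogeneity are identities between values.
\<close>

section \<open>Polynomial functions\<close>

lemma infinite_alg_closed_field: "infinite (UNIV :: 'k::alg_closed_field set)"
proof
  assume fin: "finite (UNIV :: 'k set)"
  define P :: "'k poly" where "P = (\<Prod>a\<in>UNIV. [:- a, 1:]) + 1"
  have "degree (\<Prod>a\<in>UNIV. [:- a, 1:] :: 'k poly) = card (UNIV :: 'k set)"
    by (subst degree_prod_eq_sum_degree) auto
  moreover have "card (UNIV :: 'k set) > 0"
    using fin by (simp add: card_gt_0_iff)
  ultimately have "degree P > 0"
    unfolding P_def by (subst degree_add_eq_left) auto
  then obtain z where "poly P z = 0"
    using alg_closed_imp_poly_has_root by blast
  moreover have "poly P z = 1"
    using fin by (auto simp: P_def poly_prod)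
  ultimately show False by simp
qed

lemma poly_eq_if_infinite_agree:
  fixes P Q :: "'a::idom poly"
  assumes "infinite {x. poly P x = poly Q x}"
  shows "P = Q"
proof (rule ccontr)
  assume "P \<noteq> Q"
  then have "finite {x. poly (P - Q) x = 0}" by (intro poly_roots_finite) auto
  with assms show False by simp
qed

lemma poly_eq_if_agree:
  fixes P Q :: "'a::idom poly"
  assumes "infinite (UNIV :: 'a set)" and "\<And>x. poly P x = poly Q x"
  shows "P = Q"
  using assms by (intro poly_eq_if_infinite_agree) auto

lemma poly_eq_if_agree_nonzero:
  fixes P Q :: "'a::idom poly"
  assumes "infinite (UNIV :: 'a set)" and "\<And>x. x \<noteq> 0 \<Longrightarrow> poly P x = poly Q x"
  shows "P = Q"
proof (rule poly_eq_if_infinite_agree)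
  have "infinite (UNIV - {0} :: 'a set)" using assms(1) by simp
  then show "infinite {x. poly P x = poly Q x}"
    by (rule infinite_super[rotated]) (use assms(2) in blast)
qed

text \<open>
  Polynomial functions in the coordinates \<open>V\<close>. The inductive form makes substitution, division by a
  coordinate and decomposition into homogeneous parts straightforward inductions.
\<close>

inductive polyfun :: "'v set \<Rightarrow> (('v \<Rightarrow> 'a::comm_ring_1) \<Rightarrow> 'a) \<Rightarrow> bool" for V where
  const: "polyfun V (\<lambda>p. c)"
| coord: "u \<in> V \<Longrightarrow> polyfun V (\<lambda>p. p u)"
| add: "polyfun V F \<Longrightarrow> polyfun V G \<Longrightarrow> polyfun V (\<lambda>p. F p + G p)"
| mult: "polyfun V F \<Longrightarrow> polyfun V G \<Longrightarrow> polyfun V (\<lambda>p. F p * G p)"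

lemma polyfun_diff:
  assumes "polyfun V F" "polyfun V G"
  shows "polyfun V (\<lambda>p. F p - G p)"
  using polyfun.add[OF assms(1) polyfun.mult[OF polyfun.const[of V "-1"] assms(2)]] by simp

lemma polyfun_sum: "(\<And>i. i \<in> A \<Longrightarrow> polyfun V (F i)) \<Longrightarrow> polyfun V (\<lambda>p. \<Sum>i\<in>A. F i p)"
  by (induction A rule: infinite_finite_induct) (auto intro: polyfun.intros)

lemma polyfun_prod: "(\<And>i. i \<in> A \<Longrightarrow> polyfun V (F i)) \<Longrightarrow> polyfun V (\<lambda>p. \<Prod>i\<in>A. F i p)"
  by (induction A rule: infinite_finite_induct) (auto intro: polyfun.intros)

lemma polyfun_power: "polyfun V F \<Longrightarrow> polyfun V (\<lambda>p. F p ^ n)"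
  by (induction n) (auto intro: polyfun.intros)

lemma polyfun_mono: "polyfun V F \<Longrightarrow> V \<subseteq> W \<Longrightarrow> polyfun W F"
  by (induction rule: polyfun.induct) (auto intro: polyfun.intros)

lemma polyfun_cong: "polyfun V F \<Longrightarrow> (\<And>u. u \<in> V \<Longrightarrow> p u = p' u) \<Longrightarrow> F p = F p'"
  by (induction rule: polyfun.induct) auto

lemma polyfun_compose:
  "polyfun V F \<Longrightarrow> (\<And>u. u \<in> V \<Longrightarrow> polyfun W (\<sigma> u)) \<Longrightarrow> polyfun W (\<lambda>p. F (\<lambda>u. \<sigma> u p))"
  by (induction rule: polyfun.induct) (auto intro: polyfun.intros)

text \<open>
  Restricting to a polynomially parametrised curve turns identities between polynomial functions into
  identities between polynomials in one variable, where a nonzero polynomial has finitely many roots.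
\<close>

lemma polyfun_along_curve:
  "polyfun V F \<Longrightarrow> \<exists>P. \<forall>t. F (\<lambda>u. poly (\<gamma> u) t) = poly P t"
proof (induction rule: polyfun.induct)
  case (const c) show ?case by (intro exI[of _ "[:c:]"]) simp
next
  case (coord u) show ?case by (intro exI[of _ "\<gamma> u"]) simp
next
  case (add F G) then show ?case by (metis poly_add)
next
  case (mult F G) then show ?case by (metis poly_mult)
qed

lemma polyfun_along_line:
  assumes "polyfun V F"
  shows "\<exists>P. \<forall>t. F (p(u := t)) = poly P t"
proof -
  have "p(u := t) = (\<lambda>v. poly (if v = u then [:0, 1:] else [:p v:]) t)" for t
    by auto
  then show ?thesis
    using polyfun_along_curve[OF assms, of "\<lambda>v. if v = u then [:0, 1:] else [:p v:]"] by simp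
qed

lemma polyfun_along_scaling:
  assumes "polyfun V F"
  shows "\<exists>P. \<forall>t. F (\<lambda>v. if v \<in> W then t * p v else p v) = poly P t"
proof -
  have "(\<lambda>v. if v \<in> W then t * p v else p v) = (\<lambda>v. poly (if v \<in> W then [:0, p v:] else [:p v:]) t)" for t
    by auto
  then show ?thesis
    using polyfun_along_curve[OF assms, of "\<lambda>v. if v \<in> W then [:0, p v:] else [:p v:]"] by simp
qed

text \<open>Density of the complement of a hypersurface, in the weak form in which only a line through
  the point in question has to leave the hypersurface.\<close>

lemma polyfun_zero_by_density:
  fixes F K :: "('v \<Rightarrow> 'a::idom) \<Rightarrow> 'a"
  assumes inf: "infinite (UNIV :: 'a set)" and "polyfun V F" and "polyfun W K"
    and zero: "\<And>t. K (p(u := t)) * F (p(u := t)) = 0" and nz: "K (p(u := t\<^sub>0)) \<noteq> 0"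
  shows "F p = 0"
proof -
  obtain P where P: "\<And>t. F (p(u := t)) = poly P t"
    using polyfun_along_line[OF assms(2)] by metis
  obtain R where R: "\<And>t. K (p(u := t)) = poly R t"
    using polyfun_along_line[OF assms(3)] by metis
  have "R * P = 0"
    by (rule poly_eq_if_agree[OF inf]) (use zero in \<open>simp add: P R\<close>)
  moreover have "R \<noteq> 0" using nz R by force
  ultimately have "P = 0" by simp
  then show ?thesis using P[of "p u"] by simp
qed

lemma polyfun_zero_if_coord_mult_zero:
  fixes F :: "('v \<Rightarrow> 'a::idom) \<Rightarrow> 'a"
  assumes "infinite (UNIV :: 'a set)" and "polyfun V F" and "\<And>p. p u * F p = 0"
  shows "F p = 0"
  by (rule polyfun_zero_by_density[OF assms(1,2) polyfun.coord[of u "{u}"], where u = u and t\<^sub>0 = 1])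
    (use assms(3)[of "p(u := _)"] in auto)

lemma polyfun_divide_coord:
  "polyfun V F \<Longrightarrow> u \<in> V \<Longrightarrow> \<exists>H. polyfun V H \<and> (\<forall>p. F p = F (p(u := 0)) + p u * H p)"
proof (induction rule: polyfun.induct)
  case (const c) then show ?case by (intro exI[of _ "\<lambda>p. 0"]) (auto intro: polyfun.intros)
next
  case (coord v) then show ?case
    by (intro exI[of _ "\<lambda>p. if v = u then 1 else 0"]) (auto intro: polyfun.intros)
next
  case (add F G)
  then obtain H K where HK: "polyfun V H" "\<And>p. F p = F (p(u := 0)) + p u * H p"
    "polyfun V K" "\<And>p. G p = G (p(u := 0)) + p u * K p" by metis
  have "F p + G p = F (p(u := 0)) + G (p(u := 0)) + p u * (H p + K p)" for p
    by (subst HK(2), subst HK(4)) (simp add: algebra_simps)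
  then show ?case
    using polyfun.add[OF HK(1,3)] by blast
next
  case (mult F G)
  then obtain H K where HK: "polyfun V H" "\<And>p. F p = F (p(u := 0)) + p u * H p"
    "polyfun V K" "\<And>p. G p = G (p(u := 0)) + p u * K p" by metis
  have "polyfun V (\<lambda>p. F p - p u * H p)"
    using mult.hyps mult.prems HK(1,3) by (intro polyfun_diff polyfun.intros)
  then have "polyfun V (\<lambda>p. G p * H p + (F p - p u * H p) * K p)"
    using mult.hyps HK(1,3) by (intro polyfun.intros)
  moreover have "F p * G p = F (p(u := 0)) * G (p(u := 0)) + p u * (G p * H p + (F p - p u * H p) * K p)" for p
  proof -
    have f: "F (p(u := 0)) = F p - p u * H p" using HK(2)[of p] by simp
    have g: "G (p(u := 0)) = G p - p u * K p" using HK(4)[of p] by simp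
    show ?thesis unfolding f g by (simp add: algebra_simps)
  qed
  ultimately show ?case by (intro exI[of _ "\<lambda>p. G p * H p + (F p - p u * H p) * K p"]) blast
qed

section \<open>Homogeneity in one vector\<close>

definition scale :: "nat \<Rightarrow> 'a \<Rightarrow> (nat \<times> 'c \<Rightarrow> 'a) \<Rightarrow> nat \<times> 'c \<Rightarrow> 'a::comm_ring_1" where
  "scale i t p = (\<lambda>(l, c). if l = i then t * p (l, c) else p (l, c))"

lemma scale_apply: "scale i t p (l, c) = (if l = i then t * p (l, c) else p (l, c))"
  by (simp add: scale_def)

lemma scale_as_scaling: "scale i t p = (\<lambda>v. if v \<in> {i} \<times> UNIV then t * p v else p v)"
  by (auto simp: scale_def)

lemma scale_scale: "scale i t (scale i s p) = scale i (t * s) p"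
  by (auto simp: scale_def mult.assoc)

lemma scale_1: "scale i 1 p = p"
  by (auto simp: scale_def)

lemma scale_commute: "scale i t (scale j s p) = scale j s (scale i t p)"
  by (auto simp: scale_def mult_ac)

lemma polyfun_scale: "polyfun V F \<Longrightarrow> polyfun V (\<lambda>p. F (scale i t p))"
  unfolding scale_as_scaling
proof (erule polyfun_compose)
  fix u assume "u \<in> V"
  then show "polyfun V (\<lambda>p. if u \<in> {i} \<times> UNIV then t * p u else p u)"
    by (cases "u \<in> {i} \<times> UNIV") (simp_all add: polyfun.intros)
qed

text \<open>
  Quotients of homogeneous functions are seen to be homogeneous only for nonzero scaling factors; the
  missing factor \<open>0\<close> follows because both sides are polynomials in the factor.
\<close>

lemma polyfun_homogeneous_at_zero:
  fixes F :: "(nat \<times> 'c \<Rightarrow> 'a::idom) \<Rightarrow> 'a"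
  assumes inf: "infinite (UNIV :: 'a set)" and "polyfun V F"
    and "\<And>t. t \<noteq> 0 \<Longrightarrow> F (scale i t p) = t ^ n * c"
  shows "F (scale i t p) = t ^ n * c"
proof -
  obtain P where P: "\<And>t. F (scale i t p) = poly P t"
    using polyfun_along_scaling[OF assms(2)] unfolding scale_as_scaling by metis
  have "P = monom c n"
    by (rule poly_eq_if_agree_nonzero[OF inf]) (use assms(3) in \<open>simp add: P[symmetric] poly_monom mult.commute\<close>)
  then show ?thesis by (simp add: P poly_monom mult.commute)
qed

text \<open>The homogeneous components in one vector, packed into a polynomial in the scaling factor.\<close>

lemma polyfun_homogeneous_components:
  fixes F :: "(nat \<times> 'c \<Rightarrow> 'a::idom) \<Rightarrow> 'a"
  assumes "polyfun V F"
  shows "\<exists>P N. (\<forall>p t. F (scale i t p) = poly (P p) t) \<and> (\<forall>e. polyfun V (\<lambda>p. coeff (P p) e)) \<and>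
    (\<forall>p. degree (P p) \<le> N)"
  using assms
proof (induction rule: polyfun.induct)
  case (const c)
  have "polyfun V (\<lambda>p. coeff [:c:] e)" for e by (rule polyfun.const)
  then show ?case by (intro exI[of _ "\<lambda>p. [:c:]"] exI[of _ 0]) auto
next
  case (coord u)
  obtain l c where u: "u = (l, c)" by force
  have "polyfun V (\<lambda>p. coeff (if l = i then [:0, p u:] else [:p u:]) e)" for e
    using coord by (cases "l = i"; cases e; cases "e - 1")
      (auto simp: coeff_pCons intro: polyfun.intros split: nat.splits)
  then show ?case
    by (intro exI[of _ "\<lambda>p. if l = i then [:0, p u:] else [:p u:]"] exI[of _ 1])
      (auto simp: u scale_apply)
next
  case (add F G)
  from add.IH(1) obtain P N where P: "\<forall>p t. F (scale i t p) = poly (P p) t"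
    "\<forall>e. polyfun V (\<lambda>p. coeff (P p) e)" "\<forall>p. degree (P p) \<le> N" by blast
  from add.IH(2) obtain R M where R: "\<forall>p t. G (scale i t p) = poly (R p) t"
    "\<forall>e. polyfun V (\<lambda>p. coeff (R p) e)" "\<forall>p. degree (R p) \<le> M" by blast
  have "degree (P p + R p) \<le> max N M" for p
    using P(3) R(3) by (meson degree_add_le max.cobounded1 max.cobounded2 order.trans)
  moreover have "polyfun V (\<lambda>p. coeff (P p + R p) e)" for e
    using polyfun.add P(2) R(2) by (simp add: polyfun.add)
  ultimately show ?case
    using P(1) R(1) by (intro exI[of _ "\<lambda>p. P p + R p"] exI[of _ "max N M"]) simp
next
  case (mult F G)
  from mult.IH(1) obtain P N where P: "\<forall>p t. F (scale i t p) = poly (P p) t"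
    "\<forall>e. polyfun V (\<lambda>p. coeff (P p) e)" "\<forall>p. degree (P p) \<le> N" by blast
  from mult.IH(2) obtain R M where R: "\<forall>p t. G (scale i t p) = poly (R p) t"
    "\<forall>e. polyfun V (\<lambda>p. coeff (R p) e)" "\<forall>p. degree (R p) \<le> M" by blast
  have "degree (P p * R p) \<le> N + M" for p
    using P(3) R(3) by (meson degree_mult_le add_mono order.trans)
  moreover have "polyfun V (\<lambda>p. coeff (P p * R p) e)" for e
    unfolding coeff_mult using P(2) R(2) by (intro polyfun_sum polyfun.mult) simp_all
  ultimately show ?case
    using P(1) R(1) by (intro exI[of _ "\<lambda>p. P p * R p"] exI[of _ "N + M"]) simp
qed

section \<open>Vector invariants of \<open>SL\<^sub>2\<close>\<close>

text \<open>
  A point \<open>p\<close> assigns to each index \<open>i\<close> the plane vector \<open>(p (i, False), p (i, True))\<close>, called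
  \<open>(a\<^sub>i, b\<^sub>i)\<close> in the comments.
\<close>

definition bracket :: "(nat \<times> bool \<Rightarrow> 'a::field) \<Rightarrow> nat \<Rightarrow> nat \<Rightarrow> 'a" where
  "bracket p i j = p (i, False) * p (j, True) - p (j, False) * p (i, True)"

fun bracket_monomial :: "(nat \<times> nat) list \<Rightarrow> (nat \<times> bool \<Rightarrow> 'a::field) \<Rightarrow> 'a" where
  "bracket_monomial [] p = 1"
| "bracket_monomial ((i, j) # es) p = bracket p i j * bracket_monomial es p"

text \<open>
  A product of brackets is a list of edges; its degree in the vector \<open>l\<close> is the degree of the vertex
  \<open>l\<close> in the multigraph, a loop counting twice.
\<close>

fun edge_degree :: "(nat \<times> nat) list \<Rightarrow> nat \<Rightarrow> nat" where
  "edge_degree [] l = 0"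
| "edge_degree ((i, j) # es) l = of_bool (i = l) + of_bool (j = l) + edge_degree es l"

inductive bracket_span :: "nat set \<Rightarrow> (nat \<Rightarrow> nat) \<Rightarrow> ((nat \<times> bool \<Rightarrow> 'a::field) \<Rightarrow> 'a) \<Rightarrow> bool"
  for I \<beta> where
  zero: "bracket_span I \<beta> (\<lambda>p. 0)"
| step: "bracket_span I \<beta> F \<Longrightarrow> set es \<subseteq> I \<times> I \<Longrightarrow> (\<And>l. l \<in> I \<Longrightarrow> edge_degree es l = \<beta> l) \<Longrightarrow>
    bracket_span I \<beta> (\<lambda>p. F p + c * bracket_monomial es p)"

text \<open>
  Together with the torus, the shears generate a Borel subgroup of \<open>SL\<^sub>2\<close>. Invariance under this
  subgroup already forces invariance under the whole group, so it is all that is required below.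
\<close>

definition shear :: "'a::field \<Rightarrow> (nat \<times> bool \<Rightarrow> 'a) \<Rightarrow> nat \<times> bool \<Rightarrow> 'a" where
  "shear t p = (\<lambda>(i, c). if c then p (i, True) + t * p (i, False) else p (i, False))"

definition torus :: "'a::field \<Rightarrow> (nat \<times> bool \<Rightarrow> 'a) \<Rightarrow> nat \<times> bool \<Rightarrow> 'a" where
  "torus s p = (\<lambda>(i, c). if c then inverse s * p (i, True) else s * p (i, False))"

lemma bracket_shear: "bracket (shear t p) i j = bracket p i j"
  by (simp add: bracket_def shear_def algebra_simps)

lemma bracket_torus: "s \<noteq> 0 \<Longrightarrow> bracket (torus s p) i j = bracket p i j"
  by (simp add: bracket_def torus_def field_simps)

lemma bracket_scale: "bracket (scale l t p) i j = t ^ (of_bool (i = l) + of_bool (j = l)) * bracket p i j"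
  by (auto simp: bracket_def scale_def algebra_simps)

lemma polyfun_shear: "polyfun (I \<times> UNIV) F \<Longrightarrow> polyfun (I \<times> UNIV) (\<lambda>p. F (shear t p))"
proof (erule polyfun_compose)
  fix u :: "nat \<times> bool" assume "u \<in> I \<times> UNIV"
  then show "polyfun (I \<times> UNIV) (\<lambda>p. shear t p u)"
    by (cases u; cases "snd u") (auto simp: shear_def intro!: polyfun.intros)
qed

lemma polyfun_torus: "polyfun (I \<times> UNIV) F \<Longrightarrow> polyfun (I \<times> UNIV) (\<lambda>p. F (torus s p))"
proof (erule polyfun_compose)
  fix u :: "nat \<times> bool" assume "u \<in> I \<times> UNIV"
  then show "polyfun (I \<times> UNIV) (\<lambda>p. torus s p u)"
    by (cases u; cases "snd u") (auto simp: torus_def intro!: polyfun.mult polyfun.coord polyfun.const)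
qed

lemma bracket_monomial_shear: "bracket_monomial es (shear t p) = bracket_monomial es p"
  by (induction es) (auto simp: bracket_shear)

lemma bracket_monomial_torus: "s \<noteq> 0 \<Longrightarrow> bracket_monomial es (torus s p) = bracket_monomial es p"
  by (induction es) (auto simp: bracket_torus)

lemma bracket_monomial_scale: "bracket_monomial es (scale l t p) = t ^ edge_degree es l * bracket_monomial es p"
  by (induction es) (auto simp: bracket_scale power_add mult_ac)

lemma polyfun_bracket_monomial:
  "set es \<subseteq> I \<times> I \<Longrightarrow> polyfun (I \<times> UNIV) (bracket_monomial es :: (nat \<times> bool \<Rightarrow> 'a::field) \<Rightarrow> 'a)"
proof (induction es)
  case Nil
  have "polyfun (I \<times> UNIV) (\<lambda>p :: nat \<times> bool \<Rightarrow> 'a. bracket_monomial [] p)" by (simp add: polyfun.const)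
  then show ?case by simp
next
  case (Cons e es)
  obtain i j where e: "e = (i, j)" by force
  have "polyfun (I \<times> UNIV)
      (\<lambda>p :: nat \<times> bool \<Rightarrow> 'a. (p (i, False) * p (j, True) - p (j, False) * p (i, True)) * bracket_monomial es p)"
    using Cons by (intro polyfun.mult polyfun_diff polyfun.coord) (auto simp: e)
  then have "polyfun (I \<times> UNIV) (\<lambda>p :: nat \<times> bool \<Rightarrow> 'a. bracket_monomial (e # es) p)"
    by (simp add: e bracket_def)
  then show ?case by simp
qed

lemma edge_degree_outside: "set es \<subseteq> I \<times> I \<Longrightarrow> l \<notin> I \<Longrightarrow> edge_degree es l = 0"
  by (induction es) auto

lemma bracket_span_add:
  assumes "bracket_span I \<beta> F" and "bracket_span I \<beta> G"
  shows "bracket_span I \<beta> (\<lambda>p. F p + G p)"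
  using assms(2)
proof (induction rule: bracket_span.induct)
  case zero
  then show ?case using assms(1) by simp
next
  case (step G es c)
  then show ?case using bracket_span.step[OF step.IH step.hyps(2,3), of c] by (simp add: add.assoc)
qed

lemma bracket_span_bracket_mult:
  assumes "bracket_span I \<gamma> F" and "i \<in> I" and "j \<in> I"
    and deg: "\<And>l. l \<in> I \<Longrightarrow> \<beta> l = of_bool (i = l) + of_bool (j = l) + \<gamma> l"
  shows "bracket_span I \<beta> (\<lambda>p. bracket p i j * F p)"
  using assms(1)
proof (induction rule: bracket_span.induct)
  case zero
  then show ?case by (simp add: bracket_span.zero)
next
  case (step F es c)
  have "bracket_span I \<beta> (\<lambda>p. bracket p i j * F p + c * bracket_monomial ((i, j) # es) p)"
    using step assms(2,3) by (intro bracket_span.step) (auto simp: deg)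
  then show ?case by (simp add: algebra_simps)
qed

lemma bracket_span_shear: "bracket_span I \<beta> F \<Longrightarrow> F (shear t p) = F p"
  by (induction rule: bracket_span.induct) (auto simp: bracket_monomial_shear)

lemma bracket_span_torus: "bracket_span I \<beta> F \<Longrightarrow> s \<noteq> 0 \<Longrightarrow> F (torus s p) = F p"
  by (induction rule: bracket_span.induct) (auto simp: bracket_monomial_torus)

lemma bracket_span_scale: "bracket_span I \<beta> F \<Longrightarrow> l \<in> I \<Longrightarrow> F (scale l t p) = t ^ \<beta> l * F p"
  by (induction rule: bracket_span.induct) (auto simp: bracket_monomial_scale algebra_simps)

lemma polyfun_bracket_span: "bracket_span I \<beta> F \<Longrightarrow> polyfun (I \<times> UNIV) F"
proof (induction rule: bracket_span.induct)
  case (step F es c)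
  then show ?case by (intro polyfun.add polyfun.mult polyfun.const polyfun_bracket_monomial) auto
qed (rule polyfun.const)

text \<open>
  Nonzero vectors fixed by the shears have nonnegative weight. Write \<open>(a, b)\<close> for the two coordinate
  tuples of the point. For \<open>s \<noteq> 0\<close> the pair \<open>(a + s b, b)\<close> is sheared to \<open>(a + s b, - a / s)\<close>, and the
  torus moves this to \<open>(- (b + a / s), a)\<close>. Hence \<open>s \<cdot> h (a + s b, b)\<close>, a polynomial in \<open>s\<close> without
  constant term, is up to sign a polynomial in \<open>1 / s\<close>. Both vanish, and \<open>s = 0\<close> gives \<open>h (a, b) = 0\<close>.
\<close>

lemma shear_invariant_weight_minus_one:
  fixes h :: "(nat \<times> bool \<Rightarrow> 'a::field) \<Rightarrow> 'a"
  assumes inf: "infinite (UNIV :: 'a set)" and "polyfun V h"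
    and shear: "\<And>t p. h (shear t p) = h p"
    and torus: "\<And>s p. s \<noteq> 0 \<Longrightarrow> s * h (torus s p) = h p"
  shows "h p = 0"
proof -
  define r where "r s = (\<lambda>(i, c). if c then p (i, True) else p (i, False) + s * p (i, True))" for s
  define q where "q t = (\<lambda>(i, c). if c then p (i, False) else - (p (i, True) + t * p (i, False)))" for t
  have "r s =
      (\<lambda>v. poly (if snd v then [:p (fst v, True):] else [:p (fst v, False), p (fst v, True):]) s)" for s
    by (auto simp: r_def)
  then obtain P where P: "h (r s) = poly P s" for s
    using polyfun_along_curve[OF assms(2), of "\<lambda>v. if snd v then [:p (fst v, True):] else [:p (fst v, False), p (fst v, True):]"]
    by auto
  have "q t = (\<lambda>v. poly (if snd v then [:p (fst v, False):] else [:- p (fst v, True), - p (fst v, False):]) t)" for t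
    by (auto simp: q_def)
  then obtain R where R: "h (q t) = poly R t" for t
    using polyfun_along_curve[OF assms(2), of "\<lambda>v. if snd v then [:p (fst v, False):] else [:- p (fst v, True), - p (fst v, False):]"]
    by auto
  have PR: "- s * poly P s = poly R (inverse s)" if "s \<noteq> 0" for s
  proof -
    have "shear (- inverse s) (r s) =
       torus (- s) (q (inverse s))"
    proof -
      have inv: "inverse s * (s * x) = x" "s * (inverse s * x) = x" for x
        using that by (simp_all add: mult.assoc[symmetric])
      have eq: "shear (- inverse s) (r s) (i, c) =
         torus (- s) (q (inverse s)) (i, c)" for i c
        by (cases c) (simp_all add: r_def shear_def torus_def q_def inv distrib_left right_diff_distrib)
      show ?thesis
      proof
        fix v :: "nat \<times> bool"
        obtain i c where v: "v = (i, c)" by (rule prod.exhaust)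
        show "shear (- inverse s) (r s) v =
          torus (- s) (q (inverse s)) v"
          unfolding v by (rule eq)
      qed
    qed
    then have "- s * poly P s = - s * h (torus (- s) (q (inverse s)))"
      using shear[of "- inverse s" "r s"] by (simp add: P)
    also have "\<dots> = h (q (inverse s))"
      using torus[of "- s"] that by simp
    finally show ?thesis by (simp add: R)
  qed
  have eq: "monom (- 1) (Suc (degree R)) * P = reflect_poly R"
  proof (rule poly_eq_if_agree_nonzero[OF inf])
    fix s :: 'a assume s: "s \<noteq> 0"
    have "poly (monom (- 1) (Suc (degree R)) * P) s = s ^ degree R * (- s * poly P s)"
      by (simp add: poly_monom)
    also have "\<dots> = poly (reflect_poly R) s"
      unfolding PR[OF s] using s by (simp add: poly_reflect_poly_nz)
    finally show "poly (monom (- 1) (Suc (degree R)) * P) s = poly (reflect_poly R) s" .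
  qed
  have "P = 0"
  proof (rule ccontr)
    assume "P \<noteq> 0"
    then have "degree (monom (- 1) (Suc (degree R)) * P) = Suc (degree R) + degree P"
      by (subst degree_mult_eq) (auto simp: degree_monom_eq monom_eq_0_iff)
    moreover have "degree (reflect_poly R) \<le> degree R" by (rule degree_reflect_poly_le)
    ultimately show False using eq by simp
  qed
  moreover have "r 0 = p" by (auto simp: r_def)
  ultimately show ?thesis using P[of 0] by simp
qed

text \<open>
  A function fixed by the shears with torus weight \<open>w\<close> is the same as an invariant of degree \<open>w\<close> in one
  additional vector, evaluated where that vector is \<open>(0, 1)\<close>: the bracket \<open>[i 0]\<close> then becomes the
  coordinate \<open>a\<^sub>i\<close>. Index \<open>0\<close> is reserved for the additional vector.
\<close>

definition pin :: "(nat \<times> bool \<Rightarrow> 'a::field) \<Rightarrow> nat \<times> bool \<Rightarrow> 'a" where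
  "pin p = p((0, False) := 0, (0, True) := 1)"

lemma pin_shear: "pin (shear t p) = shear t (pin p)"
  by (auto simp: pin_def shear_def)

lemma pin_torus: "s \<noteq> 0 \<Longrightarrow> pin (torus s p) = scale 0 s (torus s (pin p))"
  by (auto simp: pin_def torus_def scale_def)

lemma pin_scale: "i \<noteq> 0 \<Longrightarrow> pin (scale i t p) = scale i t (pin p)"
  by (auto simp: pin_def scale_def)

lemma polyfun_pin: "polyfun (insert 0 I \<times> UNIV) F \<Longrightarrow> polyfun (I \<times> UNIV) (\<lambda>p. F (pin p))"
proof (erule polyfun_compose)
  fix u :: "nat \<times> bool" assume "u \<in> insert 0 I \<times> UNIV"
  then show "polyfun (I \<times> UNIV) (\<lambda>p. pin p u)"
    by (cases "fst u = 0"; cases "snd u") (auto simp: pin_def intro!: polyfun.coord polyfun.const)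
qed

text \<open>
  At points with \<open>a\<^sub>x = 0\<close> the vector \<open>x\<close> is \<open>b\<^sub>x\<close> times the vector \<open>0\<close>, so replacing an endpoint \<open>0\<close> of
  an edge by \<open>x\<close> multiplies the monomial by \<open>b\<^sub>x\<close>.
\<close>

lemma replace_vertex_once:
  "edge_degree es 0 = Suc n \<Longrightarrow> set es \<subseteq> I \<times> I \<Longrightarrow> x \<noteq> 0 \<Longrightarrow>
   \<exists>es'. set es' \<subseteq> insert x I \<times> insert x I \<and> edge_degree es' 0 = n \<and> edge_degree es' x = Suc (edge_degree es x) \<and>
     (\<forall>l. l \<noteq> 0 \<and> l \<noteq> x \<longrightarrow> edge_degree es' l = edge_degree es l) \<and>
     (\<forall>p. p (x, False) = 0 \<longrightarrow> bracket_monomial es' (pin p) = p (x, True) * bracket_monomial es (pin p))"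
proof (induction es arbitrary: n)
  case Nil
  then show ?case by simp
next
  case (Cons e es)
  obtain i j where e: "e = (i, j)" by force
  consider "i = 0" | "i \<noteq> 0" "j = 0" | "i \<noteq> 0" "j \<noteq> 0" by blast
  then show ?case
  proof cases
    case 1
    then show ?thesis using Cons.prems
      by (intro exI[of _ "(x, j) # es"]) (auto simp: e bracket_def pin_def)
  next
    case 2
    then show ?thesis using Cons.prems
      by (intro exI[of _ "(i, x) # es"]) (auto simp: e bracket_def pin_def)
  next
    case 3
    then have "edge_degree es 0 = Suc n" using Cons.prems by (simp add: e)
    then obtain es' where "set es' \<subseteq> insert x I \<times> insert x I" "edge_degree es' 0 = n" "edge_degree es' x = Suc (edge_degree es x)"
      "\<forall>l. l \<noteq> 0 \<and> l \<noteq> x \<longrightarrow> edge_degree es' l = edge_degree es l"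
      "\<forall>p::nat\<times>bool \<Rightarrow> 'a. p (x, False) = 0 \<longrightarrow> bracket_monomial es' (pin p) = p (x, True) * bracket_monomial es (pin p)"
      using Cons.IH[of n] Cons.prems by auto
    then show ?thesis using 3 Cons.prems
      by (intro exI[of _ "e # es'"]) (auto simp: e)
  qed
qed

lemma replace_vertex:
  "edge_degree es 0 = w + e \<Longrightarrow> set es \<subseteq> I \<times> I \<Longrightarrow> x \<noteq> 0 \<Longrightarrow> x \<notin> I \<Longrightarrow>
   \<exists>es'. set es' \<subseteq> insert x I \<times> insert x I \<and> edge_degree es' 0 = w \<and> edge_degree es' x = e \<and>
     (\<forall>l. l \<noteq> 0 \<and> l \<noteq> x \<longrightarrow> edge_degree es' l = edge_degree es l) \<and>
     (\<forall>p. p (x, False) = 0 \<longrightarrow> bracket_monomial es' (pin p) = p (x, True) ^ e * bracket_monomial es (pin p))"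
proof (induction e arbitrary: w)
  case 0
  then show ?case by (intro exI[of _ es]) (auto simp: edge_degree_outside)
next
  case (Suc e)
  then obtain es' where es': "set es' \<subseteq> insert x I \<times> insert x I" "edge_degree es' 0 = Suc w" "edge_degree es' x = e"
    "\<forall>l. l \<noteq> 0 \<and> l \<noteq> x \<longrightarrow> edge_degree es' l = edge_degree es l"
    "\<forall>p::nat\<times>bool \<Rightarrow> 'a. p (x, False) = 0 \<longrightarrow> bracket_monomial es' (pin p) = p (x, True) ^ e * bracket_monomial es (pin p)"
    using Suc.IH[of "Suc w"] by auto
  from replace_vertex_once[OF es'(2,1) Suc.prems(3)] obtain es'' where
    "set es'' \<subseteq> insert x (insert x I) \<times> insert x (insert x I)" "edge_degree es'' 0 = w"
    "edge_degree es'' x = Suc (edge_degree es' x)" "\<forall>l. l \<noteq> 0 \<and> l \<noteq> x \<longrightarrow> edge_degree es'' l = edge_degree es' l"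
    "\<forall>p::nat\<times>bool \<Rightarrow> 'a. p (x, False) = 0 \<longrightarrow> bracket_monomial es'' (pin p) = p (x, True) * bracket_monomial es' (pin p)"
    by blast
  with es' show ?case
    by (intro exI[of _ es'']) (simp add: mult.assoc)
qed

lemma bracket_span_replace_vertex:
  assumes "bracket_span I \<beta>' F" "x \<noteq> 0" "x \<notin> I" "0 \<in> I" "\<beta>' 0 = \<beta> 0 + \<beta> x"
    "\<And>l. l \<in> I \<Longrightarrow> l \<noteq> 0 \<Longrightarrow> \<beta>' l = \<beta> l"
  shows "\<exists>G. bracket_span (insert x I) \<beta> G \<and>
    (\<forall>p. p (x, False) = 0 \<longrightarrow> G (pin p) = p (x, True) ^ \<beta> x * F (pin p))"
  using assms(1)
proof (induction rule: bracket_span.induct)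
  case zero
  then show ?case by (intro exI[of _ "\<lambda>p. 0"]) (simp add: bracket_span.zero)
next
  case (step F es c)
  from step.IH obtain G where G: "bracket_span (insert x I) \<beta> G"
    "\<forall>p. p (x, False) = 0 \<longrightarrow> G (pin p) = p (x, True) ^ \<beta> x * F (pin p)" by blast
  have "edge_degree es 0 = \<beta> 0 + \<beta> x" using step.hyps(3) assms by simp
  from replace_vertex[OF this step.hyps(2) assms(2,3)]
  obtain es' where es': "set es' \<subseteq> insert x I \<times> insert x I" "edge_degree es' 0 = \<beta> 0" "edge_degree es' x = \<beta> x"
    "\<forall>l. l \<noteq> 0 \<and> l \<noteq> x \<longrightarrow> edge_degree es' l = edge_degree es l"
    "\<forall>p::nat\<times>bool \<Rightarrow> 'a. p (x, False) = 0 \<longrightarrow> bracket_monomial es' (pin p) = p (x, True) ^ \<beta> x * bracket_monomial es (pin p)"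
    by blast
  have "edge_degree es' l = \<beta> l" if "l \<in> insert x I" for l
    using that es' step.hyps(3)[of l] assms(6)[of l] by (cases "l = 0"; cases "l = x") auto
  then have "bracket_span (insert x I) \<beta> (\<lambda>p. G p + c * bracket_monomial es' p)"
    using G(1) es'(1) by (intro bracket_span.step) auto
  then show ?case
    using G(2) es'(5) by (intro exI[of _ "\<lambda>p. G p + c * bracket_monomial es' p"]) (auto simp: algebra_simps)
qed

text \<open>
  The first fundamental theorem for \<open>SL\<^sub>2\<close> (the case \<open>\<beta> 0 = 0\<close>), proved together with its extension to
  shear-invariant functions \<open>h\<close> of weight \<open>\<beta> 0\<close>. Induction on the number of vectors, removing a vector
  \<open>x\<close> in which \<open>h\<close> has degree \<open>e\<close>: setting \<open>x = (0, 1)\<close> in \<open>h\<close> leaves a shear-invariant function of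
  weight \<open>\<beta> 0 + e\<close> in fewer vectors, which is known. Lifting it by \<open>e\<close> replacements of the vertex \<open>0\<close> by
  \<open>x\<close> gives \<open>G\<close> in the span that agrees with \<open>h\<close> where \<open>a\<^sub>x = 0\<close>. So \<open>h - G = a\<^sub>x H\<close>, where \<open>H\<close> is
  again shear-invariant and has weight smaller by one; a second induction, on the weight, ends with the
  vanishing of functions of weight \<open>-1\<close>.
\<close>

lemma covariants_bracket_span:
  fixes h :: "(nat \<times> bool \<Rightarrow> 'a::field) \<Rightarrow> 'a"
  assumes inf: "infinite (UNIV :: 'a set)" and "finite I" and "0 \<notin> I"
    and "polyfun (I \<times> UNIV) h"
    and "\<And>t p. h (shear t p) = h p"
    and "\<And>s p. s \<noteq> 0 \<Longrightarrow> h (torus s p) = s ^ \<beta> 0 * h p"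
    and "\<And>i t p. i \<in> I \<Longrightarrow> h (scale i t p) = t ^ \<beta> i * h p"
  shows "\<exists>g. bracket_span (insert 0 I) \<beta> g \<and> (\<forall>p. h p = g (pin p))"
  using assms(2-)
proof (induction I arbitrary: h \<beta> rule: finite_induct)
  case empty
  have const: "h p = h q" for p q
    using polyfun_cong[OF empty.prems(2)] by auto
  show ?case
  proof (cases "\<beta> 0 = 0")
    case True
    then have "bracket_span {0} \<beta> (\<lambda>p. 0 + h (\<lambda>_. 0) * bracket_monomial [] p)"
      by (intro bracket_span.step bracket_span.zero) auto
    then show ?thesis using const by auto
  next
    case False
    obtain s :: 'a where s: "s \<noteq> 0" "s ^ \<beta> 0 \<noteq> 1"
    proof (rule ccontr)
      assume "\<not> thesis"
      with that have "s ^ \<beta> 0 = 1" if "s \<noteq> 0" for s :: 'a using \<open>s \<noteq> 0\<close> by blast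
      then have "monom 1 (\<beta> 0) = (1 :: 'a poly)"
        by (intro poly_eq_if_agree_nonzero[OF inf]) (simp add: poly_monom)
      then show False using False by (metis degree_monom_eq degree_1 zero_neq_one)
    qed
    have "h p = 0" for p
      using empty.prems(4)[OF s(1), of p] const[of "torus s p" p] s(2) by simp
    then show ?thesis using bracket_span.zero by fastforce
  qed
next
  case (insert x J)
  define I where "I = insert x J"
  have x: "x \<noteq> 0" "0 \<notin> J" "0 \<notin> I" using insert.prems(1) by (auto simp: I_def)
  define ok where "ok \<beta> h \<longleftrightarrow> polyfun (I \<times> UNIV) h \<and> (\<forall>t p. h (shear t p) = h p) \<and>
      (\<forall>s p. s \<noteq> 0 \<longrightarrow> h (torus s p) = s ^ \<beta> 0 * h p) \<and>
      (\<forall>i t p. i \<in> I \<longrightarrow> h (scale i t p) = t ^ \<beta> i * h p)"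
    for h :: "(nat \<times> bool \<Rightarrow> 'a) \<Rightarrow> 'a" and \<beta>
  have divide: "\<exists>G H. bracket_span (insert 0 I) \<beta> G \<and> (\<forall>p. h p = G (pin p) + p (x, False) * H p) \<and>
      polyfun (I \<times> UNIV) H \<and> (\<forall>t p. H (shear t p) = H p) \<and>
      (\<forall>s p. s \<noteq> 0 \<longrightarrow> s * H (torus s p) = s ^ \<beta> 0 * H p) \<and>
      (\<forall>i t p. i \<in> J \<longrightarrow> H (scale i t p) = t ^ \<beta> i * H p) \<and>
      (\<forall>e t p. \<beta> x = Suc e \<longrightarrow> H (scale x t p) = t ^ e * H p) \<and>
      (\<beta> x = 0 \<longrightarrow> (\<forall>p. H p = 0))"
    if "ok \<beta> h" for h \<beta>
  proof -
    have h: "polyfun (I \<times> UNIV) h" "\<And>t p. h (shear t p) = h p"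
      "\<And>s p. s \<noteq> 0 \<Longrightarrow> h (torus s p) = s ^ \<beta> 0 * h p"
      "\<And>i t p. i \<in> I \<Longrightarrow> h (scale i t p) = t ^ \<beta> i * h p"
      using that by (auto simp: ok_def)
    define e where "e = \<beta> x"
    \<comment> \<open>The coefficient of the highest power of \<open>b\<^sub>x\<close> in \<open>h\<close>, as a function of the other vectors.\<close>
    define spec :: "(nat \<times> bool \<Rightarrow> 'a) \<Rightarrow> nat \<times> bool \<Rightarrow> 'a"
      where "spec p = p((x, False) := 0, (x, True) := 1)" for p
    define \<beta>' where "\<beta>' = \<beta>(0 := \<beta> 0 + e)"
    have "polyfun (J \<times> UNIV) (\<lambda>p. h (spec p))"
    proof (rule polyfun_compose[OF h(1)])
      fix u :: "nat \<times> bool" assume "u \<in> I \<times> UNIV"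
      then show "polyfun (J \<times> UNIV) (\<lambda>p. spec p u)"
        by (cases "fst u = x"; cases "snd u")
          (auto simp: spec_def I_def intro!: polyfun.coord polyfun.const)
    qed
    moreover have "h (spec (shear t p)) = h (spec p)" for t p
    proof -
      have "spec (shear t p) = shear t (spec p)" by (auto simp: spec_def shear_def)
      then show ?thesis using h(2) by simp
    qed
    moreover have "h (spec (torus s p)) = s ^ \<beta>' 0 * h (spec p)" if "s \<noteq> 0" for s p
    proof -
      have "spec (torus s p) = scale x s (torus s (spec p))"
        using that by (auto simp: spec_def torus_def scale_def)
      then show ?thesis using h(3)[OF that] h(4)[of x]
        by (simp add: I_def \<beta>'_def e_def power_add mult_ac)
    qed
    moreover have "h (spec (scale i t p)) = t ^ \<beta>' i * h (spec p)" if "i \<in> J" for i t p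
    proof -
      have "i \<noteq> x" "i \<noteq> 0" using that insert.hyps(2) x(2) by metis+
      then have "spec (scale i t p) = scale i t (spec p)" by (auto simp: spec_def scale_def)
      then show ?thesis using h(4)[of i] that \<open>i \<noteq> 0\<close> by (simp add: I_def \<beta>'_def)
    qed
    ultimately obtain g where g: "bracket_span (insert 0 J) \<beta>' g" "\<And>p. h (spec p) = g (pin p)"
      using insert.IH[OF x(2), of "\<lambda>p. h (spec p)" \<beta>'] by blast
    from bracket_span_replace_vertex[OF g(1) x(1), of \<beta>] insert.hyps(2) x
    obtain G where "bracket_span (insert x (insert 0 J)) \<beta> G" and
      G_lift: "\<And>p. p (x, False) = 0 \<Longrightarrow> G (pin p) = p (x, True) ^ e * g (pin p)"
      by (auto simp: \<beta>'_def e_def)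
    then have G: "bracket_span (insert 0 I) \<beta> G" by (simp add: I_def insert_commute)
    define D where "D p = h p - G (pin p)" for p
    have D_poly: "polyfun (I \<times> UNIV) D" unfolding D_def
      by (intro polyfun_diff h(1) polyfun_pin polyfun_bracket_span[OF G])
    have D_0: "D p = 0" if "p (x, False) = 0" for p
    proof -
      have "p = scale x (p (x, True)) (spec p)"
        using that by (auto simp: spec_def scale_def)
      then have "h p = p (x, True) ^ e * h (spec p)"
        using h(4)[of x "p (x, True)" "spec p"] by (simp add: I_def e_def)
      then show ?thesis using G_lift[of p, OF that] g(2) by (simp add: D_def)
    qed
    have D_shear: "D (shear t p) = D p" for t p
      by (simp add: D_def h(2) pin_shear bracket_span_shear[OF G])
    have D_torus: "D (torus s p) = s ^ \<beta> 0 * D p" if "s \<noteq> 0" for s p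
      using that by (simp add: D_def h(3) pin_torus bracket_span_scale[OF G] bracket_span_torus[OF G] algebra_simps)
    have D_scale: "D (scale i t p) = t ^ \<beta> i * D p" if "i \<in> I" for i t p
    proof -
      have "i \<noteq> 0" using that x(3) by metis
      then show ?thesis
        using that by (simp add: D_def h(4) pin_scale bracket_span_scale[OF G] algebra_simps)
    qed
    obtain H where H: "polyfun (I \<times> UNIV) H" "\<And>p. D p = D (p((x, False) := 0)) + p (x, False) * H p"
      using polyfun_divide_coord[OF D_poly, of "(x, False)"] by (auto simp: I_def)
    have DH: "D p = p (x, False) * H p" for p
      using H(2)[of p] D_0[of "p((x, False) := 0)"] by simp
    have cancel: "F p = 0" if "polyfun W F" "\<And>p. p (x, False) * F p = 0"
      for W F and p :: "nat \<times> bool \<Rightarrow> 'a"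
      using polyfun_zero_if_coord_mult_zero[OF inf that] .
    have H_shear: "H (shear t p) = H p" for t p
    proof -
      have "polyfun (I \<times> UNIV) (\<lambda>p. H (shear t p) - H p)"
        by (intro polyfun_diff polyfun_shear[OF H(1)] H(1))
      moreover have "p (x, False) * (H (shear t p) - H p) = 0" for p
        using D_shear[of t p] by (simp add: DH shear_def right_diff_distrib)
      ultimately have "H (shear t p) - H p = 0" by (rule cancel)
      then show ?thesis by simp
    qed
    have H_torus: "s * H (torus s p) = s ^ \<beta> 0 * H p" if "s \<noteq> 0" for s p
    proof -
      have "polyfun (I \<times> UNIV) (\<lambda>p. s * H (torus s p) - s ^ \<beta> 0 * H p)"
        by (intro polyfun_diff polyfun.mult polyfun.const polyfun_torus[OF H(1)] H(1))
      moreover have "p (x, False) * (s * H (torus s p) - s ^ \<beta> 0 * H p) = 0" for p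
        using D_torus[OF that, of p] by (simp add: DH torus_def right_diff_distrib mult_ac)
      ultimately have "s * H (torus s p) - s ^ \<beta> 0 * H p = 0" by (rule cancel)
      then show ?thesis by simp
    qed
    have H_scale: "H (scale i t p) = t ^ \<beta> i * H p" if "i \<in> J" for i t p
    proof -
      have "polyfun (I \<times> UNIV) (\<lambda>p. H (scale i t p) - t ^ \<beta> i * H p)"
        by (intro polyfun_diff polyfun.mult polyfun.const polyfun_scale[OF H(1)] H(1))
      moreover have "p (x, False) * (H (scale i t p) - t ^ \<beta> i * H p) = 0" for p
      proof -
        have "i \<noteq> x" using that insert.hyps(2) by auto
        then show ?thesis
          using D_scale[of i t p] that by (simp add: DH scale_apply right_diff_distrib I_def mult.left_commute)
      qed
      ultimately have "H (scale i t p) - t ^ \<beta> i * H p = 0" by (rule cancel)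
      then show ?thesis by simp
    qed
    have H_scale_x: "H (scale x t p) = t ^ e' * H p" if "\<beta> x = Suc e'" for e' t p
    proof (rule polyfun_homogeneous_at_zero[OF inf H(1)])
      fix t :: 'a assume "t \<noteq> 0"
      have "polyfun (I \<times> UNIV) (\<lambda>p. H (scale x t p) - t ^ e' * H p)"
        by (intro polyfun_diff polyfun.mult polyfun.const polyfun_scale[OF H(1)] H(1))
      moreover have "p (x, False) * (H (scale x t p) - t ^ e' * H p) = 0" for p
        using D_scale[of x t p] \<open>t \<noteq> 0\<close> that
        by (simp add: DH scale_apply right_diff_distrib I_def mult.left_commute)
      ultimately have "H (scale x t p) - t ^ e' * H p = 0" by (rule cancel)
      then show "H (scale x t p) = t ^ e' * H p" by simp
    qed
    \<comment> \<open>In degree \<open>0\<close> the vector \<open>x\<close> may be replaced by \<open>0\<close>, where \<open>a\<^sub>x = 0\<close>.\<close>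
    have H_zero: "H p = 0" if "\<beta> x = 0" for p
    proof (rule cancel[OF H(1)])
      fix p
      have "D p = D (scale x 0 p)" using D_scale[of x 0 p] that by (simp add: I_def)
      also have "\<dots> = 0" by (rule D_0) (simp add: scale_def)
      finally show "p (x, False) * H p = 0" by (simp add: DH)
    qed
    have "h p = G (pin p) + p (x, False) * H p" for p
      using DH[of p] by (simp add: D_def algebra_simps)
    with G H(1) H_shear H_torus H_scale H_scale_x H_zero show ?thesis
      by (intro exI[of _ G] exI[of _ H]) blast
  qed
  have "\<exists>g. bracket_span (insert 0 I) \<beta> g \<and> (\<forall>p. h p = g (pin p))"
    if "ok \<beta> h"
    using that
  proof (induction "\<beta> 0" arbitrary: h \<beta>)
    case (0 \<beta> h)
    from divide[OF 0(2)]
    obtain G H where GH: "bracket_span (insert 0 I) \<beta> G" "\<And>p. h p = G (pin p) + p (x, False) * H p"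
      "polyfun (I \<times> UNIV) H" "\<And>t p. H (shear t p) = H p"
      "\<And>s p. s \<noteq> 0 \<Longrightarrow> s * H (torus s p) = s ^ 0 * H p"
      unfolding 0(1)[symmetric] by blast
    have "H p = 0" for p
      by (rule shear_invariant_weight_minus_one[OF inf GH(3,4)]) (use GH(5) in simp)
    then show ?case using GH(1,2) by auto
  next
    case (Suc w \<beta> h)
    from divide[OF Suc.prems]
    obtain G H where G: "bracket_span (insert 0 I) \<beta> G" "\<forall>p. h p = G (pin p) + p (x, False) * H p"
      and H: "polyfun (I \<times> UNIV) H" "\<forall>t p. H (shear t p) = H p"
      "\<forall>s p. s \<noteq> 0 \<longrightarrow> s * H (torus s p) = s ^ \<beta> 0 * H p"
      "\<forall>i t p. i \<in> J \<longrightarrow> H (scale i t p) = t ^ \<beta> i * H p"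
      "\<forall>e t p. \<beta> x = Suc e \<longrightarrow> H (scale x t p) = t ^ e * H p"
      "\<beta> x = 0 \<longrightarrow> (\<forall>p. H p = 0)"
      by (elim exE conjE) (erule (7) that)
    show ?case
    proof (cases "\<beta> x")
      case 0
      then show ?thesis using G H(6) by auto
    next
      case (Suc e)
      define \<gamma> where "\<gamma> = \<beta>(0 := w, x := e)"
      have "\<exists>g. bracket_span (insert 0 I) \<gamma> g \<and> (\<forall>p. H p = g (pin p))"
      proof (rule Suc.hyps(1))
        show "w = \<gamma> 0" using x by (simp add: \<gamma>_def)
        have "H (torus s p) = s ^ \<gamma> 0 * H p" if "s \<noteq> 0" for s p
          using H(3)[rule_format, OF that, of p] Suc.hyps(2)[symmetric] that x by (simp add: \<gamma>_def)
        moreover have "H (scale i t p) = t ^ \<gamma> i * H p" if "i \<in> I" for i t p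
        proof (cases "i = x")
          case True
          then show ?thesis using H(5) Suc by (simp add: \<gamma>_def)
        next
          case False
          then have "i \<in> J" "i \<noteq> 0" using that x(2) by (auto simp: I_def intro: gr0I)
          then show ?thesis using H(4) False by (simp add: \<gamma>_def)
        qed
        ultimately show "ok \<gamma> H" using H(1,2) by (simp add: ok_def)
      qed
      then obtain g where g: "bracket_span (insert 0 I) \<gamma> g" "\<And>p. H p = g (pin p)" by blast
      have "bracket_span (insert 0 I) \<beta> (\<lambda>p. bracket p x 0 * g p)"
        by (rule bracket_span_bracket_mult[OF g(1)]) (use x Suc Suc.hyps(2) in \<open>auto simp: \<gamma>_def I_def\<close>)
      with G(1) have "bracket_span (insert 0 I) \<beta> (\<lambda>p. G p + bracket p x 0 * g p)" by (rule bracket_span_add)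
      moreover have "h p = G (pin p) + bracket (pin p) x 0 * g (pin p)" for p
        using G(2) g(2) x by (simp add: bracket_def pin_def)
      ultimately show ?thesis by blast
    qed
  qed
  moreover have "ok \<beta> h" using insert.prems(2-) unfolding ok_def I_def by blast
  ultimately show ?case unfolding I_def by blast
qed

section \<open>Evaluation and substitution\<close>

definition monomial_value :: "('v \<Rightarrow> 'b::comm_ring_1) \<Rightarrow> ('v \<Rightarrow>\<^sub>0 nat) \<Rightarrow> 'b" where
  "monomial_value \<sigma> t = (\<Prod>u\<in>Poly_Mapping.keys t. \<sigma> u ^ Poly_Mapping.lookup t u)"

text \<open>
  Evaluation at a point and substitution of polynomials for the variables are the two instances of this
  map, with the identity and the constant polynomials as coefficient maps \<open>c\<close>.
\<close>

definition poly_subst :: "('a \<Rightarrow> 'b) \<Rightarrow> ('v \<Rightarrow> 'b) \<Rightarrow> (('v \<Rightarrow>\<^sub>0 nat) \<Rightarrow>\<^sub>0 'a::comm_ring_1) \<Rightarrow> 'b::comm_ring_1" where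
  "poly_subst c \<sigma> f = (\<Sum>t\<in>Poly_Mapping.keys f. c (Poly_Mapping.lookup f t) * monomial_value \<sigma> t)"

lemma monomial_value_superset: "finite A \<Longrightarrow> Poly_Mapping.keys t \<subseteq> A \<Longrightarrow> monomial_value \<sigma> t = (\<Prod>u\<in>A. \<sigma> u ^ Poly_Mapping.lookup t u)"
  unfolding monomial_value_def by (rule prod.mono_neutral_left) (auto simp: in_keys_iff)

lemma monomial_value_add: "monomial_value \<sigma> (s + t) = monomial_value \<sigma> s * monomial_value \<sigma> t"
proof -
  have "Poly_Mapping.keys (s + t) \<subseteq> Poly_Mapping.keys s \<union> Poly_Mapping.keys t" by (rule Poly_Mapping.keys_add)
  then show ?thesis
    by (simp add: monomial_value_superset[of "Poly_Mapping.keys s \<union> Poly_Mapping.keys t"] lookup_add power_add prod.distrib)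
qed

lemma monomial_value_0 [simp]: "monomial_value \<sigma> 0 = 1"
  by (simp add: monomial_value_def)

lemma monomial_value_single_1 [simp]: "monomial_value \<sigma> (Poly_Mapping.single u (Suc 0)) = \<sigma> u"
  by (simp add: monomial_value_def)

locale coefficient_hom =
  fixes c :: "'a::comm_ring_1 \<Rightarrow> 'b::comm_ring_1"
  assumes add: "c (x + y) = c x + c y" and mult: "c (x * y) = c x * c y" and one: "c 1 = 1"
begin

lemma zero: "c 0 = 0"
  using add[of 0 0] by simp

lemma poly_subst_add: "poly_subst c \<sigma> (f + g) = poly_subst c \<sigma> f + poly_subst c \<sigma> g"
  unfolding poly_subst_def
  by (rule setsum_keys_plus_distrib) (simp_all add: zero add distrib_right)

lemma poly_subst_0: "poly_subst c \<sigma> 0 = 0"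
  by (simp add: poly_subst_def)

lemma poly_subst_sum: "poly_subst c \<sigma> (\<Sum>i\<in>A. f i) = (\<Sum>i\<in>A. poly_subst c \<sigma> (f i))"
  by (induction A rule: infinite_finite_induct) (auto simp: poly_subst_add poly_subst_0)

lemma poly_subst_single: "poly_subst c \<sigma> (Poly_Mapping.single t a) = c a * monomial_value \<sigma> t"
  by (cases "a = 0") (auto simp: poly_subst_def zero)

lemma poly_mapping_as_sum: "f = (\<Sum>t\<in>Poly_Mapping.keys f. Poly_Mapping.single t (Poly_Mapping.lookup f t))"
proof (rule poly_mapping_eqI)
  fix s
  have "Poly_Mapping.lookup (\<Sum>t\<in>Poly_Mapping.keys f. Poly_Mapping.single t (Poly_Mapping.lookup f t)) s =
     (\<Sum>t\<in>Poly_Mapping.keys f. if t = s then Poly_Mapping.lookup f s else 0)"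
    by (auto simp: lookup_sum lookup_single when_def intro: sum.cong)
  then show "Poly_Mapping.lookup f s = Poly_Mapping.lookup (\<Sum>t\<in>Poly_Mapping.keys f. Poly_Mapping.single t (Poly_Mapping.lookup f t)) s"
    by (auto simp: in_keys_iff)
qed

lemma poly_subst_mult: "poly_subst c \<sigma> (f * g) = poly_subst c \<sigma> f * poly_subst c \<sigma> g"
proof -
  have "f * g = (\<Sum>t\<in>Poly_Mapping.keys f. Poly_Mapping.single t (Poly_Mapping.lookup f t)) * (\<Sum>t\<in>Poly_Mapping.keys g. Poly_Mapping.single t (Poly_Mapping.lookup g t))"
    using poly_mapping_as_sum[of f] poly_mapping_as_sum[of g] by simp
  also have "poly_subst c \<sigma> \<dots> = poly_subst c \<sigma> f * poly_subst c \<sigma> g"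
    by (simp add: sum_product poly_subst_sum mult_single poly_subst_single mult monomial_value_add poly_subst_def[of c \<sigma> f]
       poly_subst_def[of c \<sigma> g] mult_ac)
  finally show ?thesis .
qed

lemma poly_subst_1: "poly_subst c \<sigma> 1 = 1"
  using poly_subst_single[of \<sigma> 0 1] by (simp add: one)

lemma poly_subst_power: "poly_subst c \<sigma> (f ^ n) = poly_subst c \<sigma> f ^ n"
  by (induction n) (auto simp: poly_subst_1 poly_subst_mult)

lemma poly_subst_prod: "poly_subst c \<sigma> (\<Prod>i\<in>A. f i) = (\<Prod>i\<in>A. poly_subst c \<sigma> (f i))"
  by (induction A rule: infinite_finite_induct) (auto simp: poly_subst_1 poly_subst_mult)

end

definition ev :: "(nat \<times> 3 \<Rightarrow> 'a) \<Rightarrow> 'a::comm_ring_1 vpoly \<Rightarrow> 'a" where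
  "ev p f = poly_subst (\<lambda>x. x) p f"

interpretation id_hom: coefficient_hom "\<lambda>x. x"
  by unfold_locales auto

interpretation Const_hom: coefficient_hom Const
  by unfold_locales (auto simp: Const_def single_add mult_single)

lemma vsubst_poly_subst: "vsubst \<sigma> f = poly_subst Const \<sigma> f"
  by (simp add: vsubst_def poly_subst_def monomial_value_def)

lemma ev_hom:
  "ev p (f + g) = ev p f + ev p g" "ev p (f * g) = ev p f * ev p g" "ev p 0 = 0" "ev p 1 = 1"
  "ev p (f ^ n) = ev p f ^ n" "ev p (\<Sum>i\<in>A. h i) = (\<Sum>i\<in>A. ev p (h i))"
  "ev p (\<Prod>i\<in>A. h i) = (\<Prod>i\<in>A. ev p (h i))"
  unfolding ev_def
  by (rule id_hom.poly_subst_add id_hom.poly_subst_mult id_hom.poly_subst_0 id_hom.poly_subst_1 id_hom.poly_subst_power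
      id_hom.poly_subst_sum id_hom.poly_subst_prod)+

lemma vsubst_hom:
  "vsubst \<sigma> (f + g) = vsubst \<sigma> f + vsubst \<sigma> g" "vsubst \<sigma> (f * g) = vsubst \<sigma> f * vsubst \<sigma> g"
  "vsubst \<sigma> 0 = 0" "vsubst \<sigma> 1 = 1" "vsubst \<sigma> (f ^ n) = vsubst \<sigma> f ^ n"
  unfolding vsubst_poly_subst
  by (rule Const_hom.poly_subst_add Const_hom.poly_subst_mult Const_hom.poly_subst_0 Const_hom.poly_subst_1
      Const_hom.poly_subst_power)+

lemma ev_Const [simp]: "ev p (Const a) = a"
  by (simp add: ev_def Const_def id_hom.poly_subst_single)

lemma ev_Var [simp]: "ev p (Var u) = p u"
  by (simp add: ev_def Var_def id_hom.poly_subst_single)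

lemma vsubst_Const [simp]: "vsubst \<sigma> (Const a) = Const a"
  by (simp add: vsubst_poly_subst Const_hom.poly_subst_single) (simp add: Const_def Const_hom.poly_subst_single)

lemma vsubst_Var [simp]: "vsubst \<sigma> (Var u) = \<sigma> u"
  by (simp add: vsubst_poly_subst Var_def Const_hom.poly_subst_single Const_hom.one)

lemma ev_vsubst: "ev p (vsubst \<sigma> f) = ev (\<lambda>u. ev p (\<sigma> u)) f"
  by (simp add: vsubst_poly_subst poly_subst_def ev_hom monomial_value_def ev_def[of "\<lambda>u. ev p (\<sigma> u)"])

lemma polyfun_ev:
  assumes "f \<in> R3 m"
  shows "polyfun ({1..m} \<times> UNIV) (\<lambda>p. ev p f)"
  unfolding ev_def poly_subst_def monomial_value_def using assms
  by (intro polyfun_sum polyfun.mult polyfun.const polyfun_prod polyfun_power polyfun.coord)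
    (auto simp: R3_def)

text \<open>
  Induction on the set \<open>V\<close> of variables. Fix the exponent of one variable \<open>u\<close>: the terms in which \<open>u\<close> has
  this exponent form a coefficient of a polynomial in \<open>u\<close> that vanishes identically, so they satisfy
  the hypotheses with one variable fewer. Allowing an arbitrary index set \<open>T\<close> spares the truncation of
  exponent vectors in this step.
\<close>

lemma monomials_independent:
  fixes ex :: "'s \<Rightarrow> 'v \<Rightarrow> nat" and c :: "'s \<Rightarrow> 'a::idom"
  assumes inf: "infinite (UNIV :: 'a set)"
  shows "finite V \<Longrightarrow> finite T \<Longrightarrow>
    (\<And>s t. s \<in> T \<Longrightarrow> t \<in> T \<Longrightarrow> (\<And>v. v \<in> V \<Longrightarrow> ex s v = ex t v) \<Longrightarrow> s = t) \<Longrightarrow>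
    (\<And>p. (\<Sum>t\<in>T. c t * (\<Prod>v\<in>V. p v ^ ex t v)) = 0) \<Longrightarrow> t \<in> T \<Longrightarrow> c t = 0"
proof (induction V arbitrary: T rule: finite_induct)
  case empty
  then have "T = {t}" by blast
  then show ?case using empty(3) by simp
next
  case (insert u V)
  define T' where "T' = {s \<in> T. ex s u = ex t u}"
  have "(\<Sum>s\<in>T'. c s * (\<Prod>v\<in>V. p v ^ ex s v)) = 0" for p
  proof -
    define P where "P = (\<Sum>s\<in>T. monom (c s * (\<Prod>v\<in>V. p v ^ ex s v)) (ex s u))"
    have "poly P x = 0" for x
    proof -
      have "(\<Prod>v\<in>insert u V. (p(u := x)) v ^ ex s v) = (\<Prod>v\<in>V. p v ^ ex s v) * x ^ ex s u" for s
      proof -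
        have "(\<Prod>v\<in>V. (p(u := x)) v ^ ex s v) = (\<Prod>v\<in>V. p v ^ ex s v)"
          using insert.hyps by (intro prod.cong) auto
        then show ?thesis using insert.hyps by (simp add: mult.commute)
      qed
      then show ?thesis
        using insert.prems(3)[of "p(u := x)"] by (simp add: P_def poly_sum poly_monom mult.assoc)
    qed
    then have "P = 0" by (intro poly_eq_if_agree[OF inf]) simp
    then have "coeff P (ex t u) = 0" by simp
    also have "coeff P (ex t u) = (\<Sum>s\<in>T. if ex s u = ex t u then c s * (\<Prod>v\<in>V. p v ^ ex s v) else 0)"
      by (simp add: P_def coeff_sum if_distrib)
    also have "\<dots> = (\<Sum>s\<in>T'. c s * (\<Prod>v\<in>V. p v ^ ex s v))"
      unfolding T'_def using insert.prems(1) by (intro sum.inter_filter[symmetric])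
    finally show ?thesis .
  qed
  moreover have "s = s'" if "s \<in> T'" "s' \<in> T'" "\<And>v. v \<in> V \<Longrightarrow> ex s v = ex s' v" for s s'
  proof (rule insert.prems(2))
    show "s \<in> T" "s' \<in> T" using that(1,2) by (simp_all add: T'_def)
    show "ex s v = ex s' v" if "v \<in> insert u V" for v
      using that \<open>s \<in> T'\<close> \<open>s' \<in> T'\<close> \<open>\<And>v. v \<in> V \<Longrightarrow> ex s v = ex s' v\<close> by (cases "v = u") (simp_all add: T'_def)
  qed
  moreover have "finite T'" "t \<in> T'" using insert.prems(1,4) by (auto simp: T'_def)
  ultimately show ?case using insert.IH[of T'] by blast
qed

lemma ev_zero_imp_zero:
  fixes f :: "'a::idom vpoly"
  assumes inf: "infinite (UNIV :: 'a set)" and "\<And>p. ev p f = 0"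
  shows "f = 0"
proof (rule ccontr)
  assume "f \<noteq> 0"
  then have "Poly_Mapping.keys f \<noteq> {}" by simp
  then obtain t where t: "t \<in> Poly_Mapping.keys f" by blast
  define V where "V = (\<Union>t\<in>Poly_Mapping.keys f. Poly_Mapping.keys t)"
  have "Poly_Mapping.lookup f t = 0"
  proof (rule monomials_independent[OF inf, of V "Poly_Mapping.keys f" Poly_Mapping.lookup "Poly_Mapping.lookup f"])
    show "finite V" by (simp add: V_def)
    fix s s' assume s: "s \<in> Poly_Mapping.keys f" "s' \<in> Poly_Mapping.keys f" and eq: "\<And>v. v \<in> V \<Longrightarrow> Poly_Mapping.lookup s v = Poly_Mapping.lookup s' v"
    have "Poly_Mapping.lookup s v = Poly_Mapping.lookup s' v" for v
    proof (cases "v \<in> V")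
      case False
      then have "v \<notin> Poly_Mapping.keys s" "v \<notin> Poly_Mapping.keys s'" using s by (auto simp: V_def)
      then show ?thesis by (simp add: in_keys_iff)
    qed (rule eq)
    then show "s = s'" by (rule poly_mapping_eqI)
  next
    fix p
    have "(\<Sum>t\<in>Poly_Mapping.keys f. Poly_Mapping.lookup f t * (\<Prod>v\<in>V. p v ^ Poly_Mapping.lookup t v)) = ev p f"
      unfolding ev_def poly_subst_def
      by (intro sum.cong refl arg_cong2[where f = "(*)"] monomial_value_superset[symmetric]) (auto simp: V_def)
    then show "(\<Sum>t\<in>Poly_Mapping.keys f. Poly_Mapping.lookup f t * (\<Prod>v\<in>V. p v ^ Poly_Mapping.lookup t v)) = 0"
      by (simp add: assms(2))
  qed (use t in auto)
  then show False using t by (simp add: in_keys_iff)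
qed

lemma ev_inject:
  fixes f g :: "'a::idom vpoly"
  assumes "infinite (UNIV :: 'a set)" and "\<And>p. ev p f = ev p g"
  shows "f = g"
proof -
  have "ev p (f - g) + ev p g = ev p f" for p
    by (simp flip: ev_hom(1))
  then have "f - g = 0"
    using assms(2) by (intro ev_zero_imp_zero[OF assms(1)]) (metis add_cancel_left_left)
  then show ?thesis by simp
qed

section \<open>Traces\<close>

text \<open>
  The matrix \<open>V\<^sup>(\<^sup>i\<^sup>)\<close> over an arbitrary commutative ring: the coordinates may be field elements,
  variables or polynomials, and ring homomorphisms carry one case to another.
\<close>

definition Wmat :: "(nat \<times> 3 \<Rightarrow> 'b::comm_ring_1) \<Rightarrow> nat \<Rightarrow> 'b ^ 2 ^ 2" where
  "Wmat p i = vector [vector [p (i, 3), p (i, 1)], vector [p (i, 2), p (i, 3)]]"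

definition Wprod :: "(nat \<times> 3 \<Rightarrow> 'b::comm_ring_1) \<Rightarrow> nat list \<Rightarrow> 'b ^ 2 ^ 2" where
  "Wprod p is = foldr (\<lambda>i M. Wmat p i ** M) is (mat 1)"

definition qf :: "(nat \<times> 3 \<Rightarrow> 'b::comm_ring_1) \<Rightarrow> nat \<Rightarrow> 'b" where
  "qf p i = p (i, 1) * p (i, 2) + (p (i, 3))\<^sup>2"

lemma Wprod_Nil [simp]: "Wprod p [] = mat 1"
  and Wprod_Cons [simp]: "Wprod p (i # is) = Wmat p i ** Wprod p is"
  by (simp_all add: Wprod_def)

lemma Wprod_append: "Wprod p (is @ js) = Wprod p is ** Wprod p js"
  by (induction "is") (auto simp: matrix_mul_assoc)

lemma trace_2: "trace (A :: 'b::comm_ring_1 ^ 2 ^ 2) = A $ 1 $ 1 + A $ 2 $ 2"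
  by (simp add: trace_def sum_2)

lemma matrix_mult_2: "(A ** B) $ i $ j = A $ i $ 1 * B $ 1 $ j + A $ i $ 2 * B $ 2 $ j"
  for A B :: "'b::comm_ring_1 ^ 2 ^ 2"
  by (simp add: matrix_matrix_mult_def sum_2)

lemma Wmat_entries [simp]:
  "Wmat p i $ 1 $ 1 = p (i, 3)" "Wmat p i $ 1 $ 2 = p (i, 1)"
  "Wmat p i $ 2 $ 1 = p (i, 2)" "Wmat p i $ 2 $ 2 = p (i, 3)"
  by (simp_all add: Wmat_def)

lemma Q_qf: "Q j = qf Var j"
  by (simp add: Q_def qf_def qform_def gvec_def)

lemma Tr_trace: "Tr is = trace (Wprod (Var :: nat \<times> 3 \<Rightarrow> 'a::comm_ring_1 vpoly) is)"
proof -
  have "(Vmat :: nat \<Rightarrow> 'a vpoly ^ 2 ^ 2) = Wmat Var"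
    by (simp add: fun_eq_iff Vmat_def Wmat_def gvec_def)
  then show ?thesis by (simp add: Tr_def Wprod_def)
qed

lemma Wprod_hom:
  assumes "\<And>x y. \<phi> (x + y) = \<phi> x + \<phi> y" "\<And>x y. \<phi> (x * y) = \<phi> x * \<phi> y" "\<phi> 0 = 0" "\<phi> 1 = 1"
  shows "\<phi> (Wprod p is $ i $ j) = Wprod (\<lambda>u. \<phi> (p u)) is $ i $ j"
proof (induction "is" arbitrary: i j)
  case Nil
  show ?case using assms(3,4) by (simp add: mat_def)
next
  case (Cons l "is")
  have "\<phi> (Wmat p l $ i $ k) = Wmat (\<lambda>u. \<phi> (p u)) l $ i $ k" for k
    using exhaust_2[of i] exhaust_2[of k] by auto
  then show ?case by (simp add: matrix_mult_2 assms(1,2) Cons.IH)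
qed

lemma ev_Q: "ev p (Q j) = qf p j"
  by (simp add: Q_qf qf_def ev_hom)

lemma vsubst_Q: "vsubst \<sigma> (Q j) = qf \<sigma> j"
  by (simp add: Q_qf qf_def vsubst_hom)

lemma ev_Tr: "ev p (Tr is) = trace (Wprod p is)"
  by (simp add: Tr_trace trace_2 ev_hom Wprod_hom)

lemma vsubst_Tr: "vsubst \<sigma> (Tr is) = trace (Wprod \<sigma> is)"
  by (simp add: Tr_trace trace_2 vsubst_hom Wprod_hom)

section \<open>The orthogonal group acts by conjugation\<close>

lemma char_2_simps:
  assumes "CHAR('k::comm_ring_1) = 2"
  shows "(2 :: 'k) = 0" and "(x :: 'k) + x = 0" and "(x :: 'k) + (x + y) = y" and "- (x :: 'k) = x"
    and "(x :: 'k) - y = x + y"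
proof -
  show two: "(2 :: 'k) = 0"
    using of_nat_CHAR[where 'a = 'k] assms by simp
  have double: "x + x = 0" for x :: 'k
    using two by (metis mult_2 mult_zero_left)
  show "x + x = 0" by (rule double)
  show "x + (x + y) = y" using double by (simp add: add.assoc[symmetric])
  show "- x = x" "x - y = x + y"
    using assms by (rule uminus_CHAR_2, rule minus_CHAR_2)
qed

lemma exists_sqrt: "\<exists>y. y\<^sup>2 = (x :: 'k::alg_closed_field)"
  using nth_root_exists[of 2 x] by simp

text \<open>
  The Frobenius map is injective, so the entries of an orthogonal matrix and the points of the cone may
  be identified by their squares.
\<close>

lemma square_inj_char_2:
  assumes ch: "CHAR('k::field) = 2" and "x\<^sup>2 = (y :: 'k)\<^sup>2"
  shows "x = y"
proof -
  have "(x + y)\<^sup>2 = 0" using assms(2) by (simp add: power2_sum char_2_simps[OF ch])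
  then have "x + y = 0" by simp
  then show ?thesis using char_2_simps(4)[OF ch] by (metis add_eq_0_iff)
qed

definition act :: "'k::comm_ring_1 ^ 3 ^ 3 \<Rightarrow> (nat \<times> 3 \<Rightarrow> 'k) \<Rightarrow> nat \<times> 3 \<Rightarrow> 'k" where
  "act A p = (\<lambda>(i, c). \<Sum>d\<in>UNIV. A $ c $ d * p (i, d))"

lemma act_apply: "act A p (i, c) = A $ c $ 1 * p (i, 1) + A $ c $ 2 * p (i, 2) + A $ c $ 3 * p (i, 3)"
  by (simp add: act_def sum_3)

lemma ev_pullback: "ev p (pullback A f) = ev (act A p) f"
proof -
  have "(\<lambda>u. ev p ((\<lambda>(i, c). \<Sum>d\<in>UNIV. Const (A $ c $ d) * Var (i, d)) u)) = act A p"
    by (auto simp: act_def ev_hom)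
  then show ?thesis by (simp add: pullback_def ev_vsubst)
qed

lemma qf_act:
  assumes "A \<in> O3"
  shows "qf (act A p) i = qf p i"
proof -
  have "qform (A *v (\<chi> c. p (i, c))) = qform (\<chi> c. p (i, c))"
    using assms by (simp add: O3_def)
  then show ?thesis
    by (simp add: qform_def qf_def matrix_vector_mult_def act_def)
qed

lemma scale_act: "act A (scale l t p) = scale l t (act A p)"
  by (auto simp: act_apply scale_apply algebra_simps)

lemma polyfun_act:
  assumes "polyfun (I \<times> UNIV) F"
  shows "polyfun (I \<times> UNIV) (\<lambda>p. F (act A p))"
  using assms
proof (rule polyfun_compose)
  fix u :: "nat \<times> 3" assume "u \<in> I \<times> UNIV"
  then show "polyfun (I \<times> UNIV) (\<lambda>p. act A p u)"
    by (cases u) (auto simp: act_apply intro!: polyfun.add polyfun.mult polyfun.const polyfun.coord)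
qed

text \<open>
  Comparing values of \<open>q\<close> at the basis vectors and at their pairwise sums shows that \<open>A\<close> fixes the third
  basis vector, which spans the radical of the polar form, and acts on the quotient with determinant
  \<open>1\<close>. The upper left block of \<open>A\<close> consists of the squares of the entries of the conjugating matrix \<open>g\<close>.
\<close>

lemma O3_conjugation:
  fixes A :: "'k::alg_closed_field ^ 3 ^ 3"
  assumes ch: "CHAR('k) = 2" and A: "A \<in> O3"
  shows "\<exists>g g' :: 'k ^ 2 ^ 2. g' ** g = mat 1 \<and> (\<forall>p i. Wmat (act A p) i = g ** Wmat p i ** g')"
proof -
  note c2 = char_2_simps[OF ch]
  have q: "qf (act A p) 0 = qf p 0" for p using qf_act[OF A] .
  define E :: "'k \<Rightarrow> 'k \<Rightarrow> 'k \<Rightarrow> nat \<times> 3 \<Rightarrow> 'k"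
    where "E x y z = (\<lambda>(i, c). if c = 1 then x else if c = 2 then y else z)" for x y z
  have E: "(A $ 1 $ 1 * x + A $ 1 $ 2 * y + A $ 1 $ 3 * z) * (A $ 2 $ 1 * x + A $ 2 $ 2 * y + A $ 2 $ 3 * z)
     + (A $ 3 $ 1 * x + A $ 3 $ 2 * y + A $ 3 $ 3 * z)\<^sup>2 = x * y + z\<^sup>2" for x y z
    using q[of "E x y z"] by (simp add: qf_def act_apply E_def)
  note sq_inj = square_inj_char_2[OF ch]
  obtain a b c d where sq: "A $ 1 $ 1 = a\<^sup>2" "A $ 1 $ 2 = b\<^sup>2" "A $ 2 $ 1 = c\<^sup>2" "A $ 2 $ 2 = d\<^sup>2"
    using nth_root_exists[of 2] by (metis pos2)
  have e1: "a\<^sup>2 * c\<^sup>2 + (A $ 3 $ 1)\<^sup>2 = 0" using E[of 1 0 0] by (simp add: sq)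
  have e2: "b\<^sup>2 * d\<^sup>2 + (A $ 3 $ 2)\<^sup>2 = 0" using E[of 0 1 0] by (simp add: sq)
  have e3: "A $ 1 $ 3 * A $ 2 $ 3 + (A $ 3 $ 3)\<^sup>2 = 1" using E[of 0 0 1] by simp
  have "A $ 3 $ 1 = a * c"
    by (rule sq_inj) (use e1 in \<open>metis c2(4) add_eq_0_iff power_mult_distrib\<close>)
  moreover have "A $ 3 $ 2 = b * d"
    by (rule sq_inj) (use e2 in \<open>metis c2(4) add_eq_0_iff power_mult_distrib\<close>)
  ultimately have A3: "A $ 3 $ 1 = a * c" "A $ 3 $ 2 = b * d" by blast+
  have e12: "a\<^sup>2 * d\<^sup>2 + b\<^sup>2 * c\<^sup>2 = 1"
    using E[of 1 1 0] by (simp add: sq A3 power2_sum power_mult_distrib algebra_simps c2)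
  have "(a * d + b * c)\<^sup>2 = 1\<^sup>2"
    using e12 by (simp add: power2_sum power_mult_distrib c2)
  then have det: "a * d + b * c = 1" by (rule sq_inj)
  have e13: "a\<^sup>2 * A $ 2 $ 3 = c\<^sup>2 * A $ 1 $ 3"
  proof -
    have "(a\<^sup>2 * c\<^sup>2 + (a * c)\<^sup>2) + (a\<^sup>2 * A $ 2 $ 3 + c\<^sup>2 * A $ 1 $ 3) + (A $ 1 $ 3 * A $ 2 $ 3 + (A $ 3 $ 3)\<^sup>2) = 1"
      using E[of 1 0 1] by (simp add: sq A3 power2_sum algebra_simps c2)
    then have "a\<^sup>2 * A $ 2 $ 3 + c\<^sup>2 * A $ 1 $ 3 = 0"
      unfolding e3 by (simp add: power_mult_distrib c2)
    then show ?thesis by (metis c2(4) add_eq_0_iff)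
  qed
  have e23: "b\<^sup>2 * A $ 2 $ 3 = d\<^sup>2 * A $ 1 $ 3"
  proof -
    have "(b\<^sup>2 * d\<^sup>2 + (b * d)\<^sup>2) + (b\<^sup>2 * A $ 2 $ 3 + d\<^sup>2 * A $ 1 $ 3) + (A $ 1 $ 3 * A $ 2 $ 3 + (A $ 3 $ 3)\<^sup>2) = 1"
      using E[of 0 1 1] by (simp add: sq A3 power2_sum algebra_simps c2)
    then have "b\<^sup>2 * A $ 2 $ 3 + d\<^sup>2 * A $ 1 $ 3 = 0"
      unfolding e3 by (simp add: power_mult_distrib c2)
    then show ?thesis by (metis c2(4) add_eq_0_iff)
  qed
  have "A $ 1 $ 3 = a\<^sup>2 * (d\<^sup>2 * A $ 1 $ 3) + b\<^sup>2 * (c\<^sup>2 * A $ 1 $ 3)"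
    using arg_cong[OF e12, of "\<lambda>x. x * A $ 1 $ 3"] by (simp add: algebra_simps)
  also have "\<dots> = 0" unfolding e13[symmetric] e23[symmetric] by (simp add: mult.left_commute c2)
  finally have A13: "A $ 1 $ 3 = 0" .
  have "A $ 2 $ 3 = d\<^sup>2 * (a\<^sup>2 * A $ 2 $ 3) + c\<^sup>2 * (b\<^sup>2 * A $ 2 $ 3)"
    using arg_cong[OF e12, of "\<lambda>x. x * A $ 2 $ 3"] by (simp add: algebra_simps)
  also have "\<dots> = 0" unfolding e13 e23 A13 by simp
  finally have A23: "A $ 2 $ 3 = 0" .
  have A33: "A $ 3 $ 3 = 1"
    by (rule sq_inj) (use e3 in \<open>simp add: A13\<close>)
  define g :: "'k ^ 2 ^ 2" where "g = vector [vector [a, b], vector [c, d]]"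
  define g' :: "'k ^ 2 ^ 2" where "g' = vector [vector [d, b], vector [c, a]]"
  have g: "g $ 1 $ 1 = a" "g $ 1 $ 2 = b" "g $ 2 $ 1 = c" "g $ 2 $ 2 = d"
    and g': "g' $ 1 $ 1 = d" "g' $ 1 $ 2 = b" "g' $ 2 $ 1 = c" "g' $ 2 $ 2 = a"
    by (simp_all add: g_def g'_def)
  have "g' ** g = mat 1"
    using det by (simp add: vec_eq_iff forall_2 matrix_mult_2 g g' mat_def mult.commute add.commute c2)
  moreover have "Wmat (act A p) i = g ** Wmat p i ** g'" for p i
  proof -
    have z: "p (i, 3) = (a * d + b * c) * p (i, 3)" by (simp add: det)
    have "Wmat (act A p) i $ 1 $ 1 = (g ** Wmat p i ** g') $ 1 $ 1"
      by (simp add: matrix_mult_2 g g' act_apply sq A3 A13 A23 A33, subst z)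
        (simp add: algebra_simps power2_eq_square c2)
    moreover have "Wmat (act A p) i $ 2 $ 2 = (g ** Wmat p i ** g') $ 2 $ 2"
      by (simp add: matrix_mult_2 g g' act_apply sq A3 A13 A23 A33, subst z)
        (simp add: algebra_simps power2_eq_square c2)
    moreover have "Wmat (act A p) i $ 1 $ 2 = (g ** Wmat p i ** g') $ 1 $ 2"
      by (simp add: matrix_mult_2 g g' act_apply sq A3 A13 A23 A33)
        (simp add: algebra_simps power2_eq_square c2)
    moreover have "Wmat (act A p) i $ 2 $ 1 = (g ** Wmat p i ** g') $ 2 $ 1"
      by (simp add: matrix_mult_2 g g' act_apply sq A3 A13 A23 A33)
        (simp add: algebra_simps power2_eq_square c2)
    ultimately show ?thesis by (simp add: vec_eq_iff forall_2)
  qed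
  ultimately show ?thesis by blast
qed

lemma trace_act:
  fixes A :: "'k::alg_closed_field ^ 3 ^ 3"
  assumes ch: "CHAR('k) = 2" and A: "A \<in> O3"
  shows "trace (Wprod (act A p) is) = trace (Wprod p is)"
proof -
  obtain g g' :: "'k ^ 2 ^ 2" where g: "g' ** g = mat 1" "\<And>p i. Wmat (act A p) i = g ** Wmat p i ** g'"
    using O3_conjugation[OF assms] by blast
  have g2: "g ** g' = mat 1" using g(1) by (simp add: matrix_left_right_inverse)
  have "Wprod (act A p) is = g ** Wprod p is ** g'"
  proof (induction "is")
    case Nil
    then show ?case by (simp add: g2)
  next
    case (Cons i "is")
    have "Wprod (act A p) (i # is) = g ** Wmat p i ** (g' ** g) ** Wprod p is ** g'"
      by (simp add: Cons.IH g(2) matrix_mul_assoc)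
    then show ?case by (simp add: g(1) matrix_mul_assoc)
  qed
  then have "trace (Wprod (act A p) is) = trace (g' ** (g ** Wprod p is))"
    by (simp only: trace_mul_sym[of "g ** Wprod p is" g'])
  then show ?thesis by (simp add: matrix_mul_assoc g(1))
qed

section \<open>The algebra generated by the invariants\<close>

definition gens :: "nat \<Rightarrow> 'k::comm_ring_1 vpoly set" where
  "gens m = {Q j | j. 1 \<le> j \<and> j \<le> m} \<union>
     {Tr is | is. 2 \<le> length is \<and> length is \<le> m \<and> set is \<subseteq> {1..m} \<and> sorted_wrt (<) is}"

lemma subalgebra_hull: "subalgebra (subalgebra hull G)"
proof (rule hull_in)
  fix T assume T: "Ball T subalgebra"
  have "range Const \<subseteq> X" if "X \<in> T" for X
    using bspec[OF T that] by (simp add: subalgebra_def)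
  moreover have "f + g \<in> X" "f * g \<in> X" if "X \<in> T" "f \<in> X" "g \<in> X" for f g X
    using bspec[OF T that(1)] that(2,3) by (simp_all add: subalgebra_def)
  ultimately show "subalgebra (\<Inter>T)"
    by (simp add: subalgebra_def le_Inf_iff)
qed

lemma subalgebraD:
  assumes "subalgebra S"
  shows "Const a \<in> S" and "f \<in> S \<Longrightarrow> g \<in> S \<Longrightarrow> f + g \<in> S" and "f \<in> S \<Longrightarrow> g \<in> S \<Longrightarrow> f * g \<in> S"
  using assms by (auto simp: subalgebra_def)

definition generated :: "nat \<Rightarrow> ((nat \<times> 3 \<Rightarrow> 'k::comm_ring_1) \<Rightarrow> 'k) \<Rightarrow> bool" where
  "generated m F \<longleftrightarrow> (\<exists>f \<in> subalgebra hull gens m. \<forall>p. ev p f = F p)"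

lemma generated_const: "generated m (\<lambda>p. c)"
  unfolding generated_def
  using subalgebra_hull[of "gens m"] by (intro bexI[of _ "Const c"]) (auto simp: subalgebra_def)

lemma generated_add:
  assumes "generated m F" and "generated m G"
  shows "generated m (\<lambda>p. F p + G p)"
proof -
  obtain f g where f: "f \<in> subalgebra hull gens m" "\<forall>p. ev p f = F p"
    and g: "g \<in> subalgebra hull gens m" "\<forall>p. ev p g = G p"
    using assms unfolding generated_def by blast
  have "f + g \<in> subalgebra hull gens m"
    using f(1) g(1) subalgebra_hull[of "gens m"] unfolding subalgebra_def by blast
  then show ?thesis
    unfolding generated_def using f(2) g(2) by (intro bexI[of _ "f + g"]) (simp_all add: ev_hom)
qed

lemma generated_mult:
  assumes "generated m F" and "generated m G"
  shows "generated m (\<lambda>p. F p * G p)"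
proof -
  obtain f g where f: "f \<in> subalgebra hull gens m" "\<forall>p. ev p f = F p"
    and g: "g \<in> subalgebra hull gens m" "\<forall>p. ev p g = G p"
    using assms unfolding generated_def by blast
  have "f * g \<in> subalgebra hull gens m"
    using f(1) g(1) subalgebra_hull[of "gens m"] unfolding subalgebra_def by blast
  then show ?thesis
    unfolding generated_def using f(2) g(2) by (intro bexI[of _ "f * g"]) (simp_all add: ev_hom)
qed

lemma generated_qf: "j \<in> {1..m} \<Longrightarrow> generated m (\<lambda>p. qf p j)"
  unfolding generated_def
  by (intro bexI[of _ "Q j"]) (auto simp: ev_Q gens_def intro!: hull_inc)

lemma generated_Tr:
  "2 \<le> length is \<Longrightarrow> length is \<le> m \<Longrightarrow> set is \<subseteq> {1..m} \<Longrightarrow> sorted_wrt (<) is \<Longrightarrow>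
    generated m (\<lambda>p. trace (Wprod p is))"
  unfolding generated_def
  by (intro bexI[of _ "Tr is"]) (auto simp: ev_Tr gens_def intro!: hull_inc)

text \<open>
  The polarised Clifford relation \<open>V\<^sub>i V\<^sub>j + V\<^sub>j V\<^sub>i = Tr(V\<^sub>i V\<^sub>j)\<close>, inserted into a longer word.
\<close>

lemma trace_swap:
  assumes ch: "CHAR('k::comm_ring_1) = 2"
  shows "trace (Wprod (p :: nat \<times> 3 \<Rightarrow> 'k) (us @ i # j # vs)) =
    trace (Wprod p [i, j]) * trace (Wprod p (us @ vs)) + trace (Wprod p (us @ j # i # vs))"
proof -
  note c2 = char_2_simps[OF ch]
  define S T where "S = Wmat p i ** Wmat p j" and "T = Wmat p j ** Wmat p i"
  define b where "b = trace (Wprod p [i, j])"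
  define U V where "U = Wprod p us" and "V = Wprod p vs"
  have ST: "S $ 1 $ 1 = b + T $ 1 $ 1" "S $ 1 $ 2 = T $ 1 $ 2" "S $ 2 $ 1 = T $ 2 $ 1"
    "S $ 2 $ 2 = b + T $ 2 $ 2"
    by (simp_all add: S_def T_def b_def trace_2 matrix_mult_2 mat_def algebra_simps c2)
  have "trace (U ** (S ** V)) = b * trace (U ** V) + trace (U ** (T ** V))"
    by (simp add: trace_2 matrix_mult_2 ST algebra_simps)
  then show ?thesis
    by (simp add: Wprod_append U_def V_def S_def T_def b_def matrix_mul_assoc)
qed

lemma trace_repeat:
  assumes ch: "CHAR('k::comm_ring_1) = 2"
  shows "trace (Wprod (p :: nat \<times> 3 \<Rightarrow> 'k) (i # i # vs)) = qf p i * trace (Wprod p vs)"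
  by (simp add: trace_2 matrix_mult_2 qf_def algebra_simps power2_eq_square char_2_simps[OF ch])

text \<open>
  Modulo traces of shorter words, adjacent letters may be exchanged, so the letters may be sorted. A
  word without repetition becomes a generator, or has length at most \<open>1\<close> and trace \<open>0\<close>; a repeated
  letter can be brought next to its copy, and then \<open>V\<^sub>i\<^sup>2 = q(v\<^sub>i)\<close> shortens the word.
\<close>

lemma generated_trace:
  assumes ch: "CHAR('k::comm_ring_1) = 2"
  shows "set is \<subseteq> {1..m} \<Longrightarrow> generated m (\<lambda>p :: nat \<times> 3 \<Rightarrow> 'k. trace (Wprod p is))"
proof (induction "length is" arbitrary: "is" rule: less_induct)
  case less
  note c2 = char_2_simps[OF ch]
  define gen where "gen is \<longleftrightarrow> generated m (\<lambda>p :: nat \<times> 3 \<Rightarrow> 'k. trace (Wprod p is))" for "is"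
  have shorter: "gen js" if "length js < length is" "set js \<subseteq> {1..m}" for js
    using less.hyps that by (simp add: gen_def)
  have pair: "gen [i, j]" if "i \<in> {1..m}" "j \<in> {1..m}" for i j
  proof (cases i j rule: linorder_cases)
    case less
    then show ?thesis using that unfolding gen_def by (intro generated_Tr) auto
  next
    case equal
    have "(\<lambda>p :: nat \<times> 3 \<Rightarrow> 'k. trace (Wprod p [i, i])) = (\<lambda>p. 0)"
      by (simp add: trace_2 matrix_mult_2 mat_def algebra_simps c2)
    then show ?thesis using equal generated_const[of m 0] by (simp add: gen_def)
  next
    case greater
    have "(\<lambda>p :: nat \<times> 3 \<Rightarrow> 'k. trace (Wprod p [i, j])) = (\<lambda>p. trace (Wprod p [j, i]))"
      by (simp add: trace_2 matrix_mult_2 mat_def algebra_simps fun_eq_iff)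
    moreover have "gen [j, i]"
      using that greater unfolding gen_def by (intro generated_Tr) auto
    ultimately show ?thesis by (simp add: gen_def)
  qed
  have swap_imp: "gen (us @ i # j # vs)" if "gen (us @ j # i # vs)"
    "length (us @ i # j # vs) = length is" "set (us @ i # j # vs) \<subseteq> {1..m}" for us i j vs
  proof -
    have "gen [i, j]" using that by (intro pair) auto
    moreover have "gen (us @ vs)" using that by (intro shorter) auto
    ultimately show ?thesis
      using that(1) unfolding gen_def trace_swap[OF ch, of _ us i j vs]
      by (intro generated_add generated_mult)
  qed
  have swap: "gen (us @ i # j # vs) \<longleftrightarrow> gen (us @ j # i # vs)"
    if "length (us @ i # j # vs) = length is" "set (us @ i # j # vs) \<subseteq> {1..m}" for us i j vs
    using swap_imp[of us i j vs] swap_imp[of us j i vs] that by auto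
  have insort: "gen (us @ insort x vs) \<longleftrightarrow> gen (us @ x # vs)"
    if "length (us @ x # vs) = length is" "set (us @ x # vs) \<subseteq> {1..m}" for us x vs
    using that
  proof (induction vs arbitrary: us)
    case (Cons y vs)
    have "gen ((us @ [y]) @ insort x vs) \<longleftrightarrow> gen ((us @ [y]) @ x # vs)"
      using Cons.prems by (intro Cons.IH) auto
    moreover have "gen (us @ y # x # vs) \<longleftrightarrow> gen (us @ x # y # vs)"
      using Cons.prems by (intro swap) auto
    ultimately show ?case by simp
  qed simp
  have sort: "gen (us @ sort vs) \<longleftrightarrow> gen (us @ vs)"
    if "length (us @ vs) = length is" "set (us @ vs) \<subseteq> {1..m}" for us vs
    using that
  proof (induction vs arbitrary: us)
    case (Cons y vs)
    have "gen (us @ insort y (sort vs)) \<longleftrightarrow> gen (us @ y # sort vs)"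
      using Cons.prems by (intro insort) auto
    also have "\<dots> \<longleftrightarrow> gen ((us @ [y]) @ vs)"
      using Cons.IH[of "us @ [y]"] Cons.prems by simp
    finally show ?case by simp
  qed simp
  have "gen is"
  proof (cases "distinct is")
    case True
    have "gen (sort is)"
    proof (cases "2 \<le> length is")
      case True
      have "sorted_wrt (<) (sort is)"
        using \<open>distinct is\<close> by (simp add: strict_sorted_iff)
      moreover have "length is \<le> m"
        using less.prems \<open>distinct is\<close> card_mono[of "{1..m}" "set is"] by (simp add: distinct_card)
      ultimately show ?thesis
        using True less.prems unfolding gen_def by (intro generated_Tr) auto
    next
      case False
      then have "is = [] \<or> (\<exists>i. is = [i])"
        by (cases "is"; cases "tl is") auto
      then have "(\<lambda>p :: nat \<times> 3 \<Rightarrow> 'k. trace (Wprod p (sort is))) = (\<lambda>p. 0)"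
        by (auto simp: trace_2 mat_def c2 matrix_mult_2)
      then show ?thesis using generated_const[of m 0] by (simp add: gen_def)
    qed
    then show ?thesis using sort[of "[]" "is"] less.prems by simp
  next
    case False
    then obtain us i vs ws where is_eq: "is = us @ [i] @ vs @ [i] @ ws"
      using not_distinct_decomp by blast
    define js where "js = i # i # us @ vs @ ws"
    have "mset is = mset js" by (simp add: is_eq js_def)
    then have eq: "sort is = sort js"
      by (metis sorted_list_of_multiset_mset)
    have "set js \<subseteq> {1..m}" "length js = length is"
      using less.prems by (auto simp: is_eq js_def)
    then have *: "gen js \<longleftrightarrow> gen is"
      using sort[of "[]" js] sort[of "[]" "is"] less.prems eq by simp
    have "gen (us @ vs @ ws)" using less.prems by (intro shorter) (auto simp: is_eq)
    moreover have "generated m (\<lambda>p :: nat \<times> 3 \<Rightarrow> 'k. qf p i)"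
      using less.prems by (intro generated_qf) (auto simp: is_eq)
    ultimately have "gen js"
      unfolding gen_def js_def trace_repeat[OF ch] by (intro generated_mult)
    then show ?thesis using * by simp
  qed
  then show ?case by (simp add: gen_def)
qed

section \<open>Closed walks and traces on the cone\<close>

lemma subalgebra_R3: "subalgebra (R3 m)"
proof -
  have "range Const \<subseteq> R3 m" by (auto simp: R3_def Const_def split: if_splits)
  moreover have "f + g \<in> R3 m" if "f \<in> R3 m" "g \<in> R3 m" for f g :: "'a vpoly"
    using that Poly_Mapping.keys_add[of f g] by (fastforce simp: R3_def)
  moreover have "f * g \<in> R3 m" if "f \<in> R3 m" "g \<in> R3 m" for f g :: "'a vpoly"
    unfolding R3_def
  proof safe
    fix t u c
    assume t: "t \<in> Poly_Mapping.keys (f * g)" and u: "(u, c) \<in> Poly_Mapping.keys t"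
    obtain a b where "t = a + b" "a \<in> Poly_Mapping.keys f" "b \<in> Poly_Mapping.keys g"
      using keys_mult[of f g] t by blast
    then show "u \<in> {1..m}"
      using that u Poly_Mapping.keys_add[of a b] by (fastforce simp: R3_def)
  qed simp
  ultimately show ?thesis by (auto simp: subalgebra_def)
qed

lemma Var_in_R3: "i \<in> {1..m} \<Longrightarrow> Var (i, c) \<in> R3 m"
  by (auto simp: R3_def Var_def)

lemma subalgebra_Wprod:
  assumes S: "subalgebra S" and "\<And>i c. i \<in> set is \<Longrightarrow> p (i, c) \<in> S"
  shows "Wprod p is $ r $ s \<in> S"
  using assms(2)
proof (induction "is" arbitrary: r s)
  case Nil
  have "Const 0 \<in> S" "Const 1 \<in> S" using S by (auto simp: subalgebra_def)
  then show ?case by (auto simp: mat_def Const_def)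
next
  case (Cons i "is")
  have "Wmat p i $ r $ k \<in> S" for k
    using Cons.prems[of i] exhaust_2[of r] exhaust_2[of k] by auto
  moreover have "Wprod p is $ k $ s \<in> S" for k
    using Cons by auto
  ultimately show ?case
    using S by (simp add: matrix_mult_2 subalgebra_def)
qed

lemma gens_subset_R3: "gens m \<subseteq> R3 m"
proof
  fix f :: "'a vpoly" assume "f \<in> gens m"
  then consider j where "f = Q j" "j \<in> {1..m}" | "is" where "f = Tr is" "set is \<subseteq> {1..m}"
    by (auto simp: gens_def)
  then show "f \<in> R3 m"
  proof cases
    case 1
    then show ?thesis
      by (auto simp: Q_qf qf_def power2_eq_square intro!: subalgebraD[OF subalgebra_R3] Var_in_R3)
  next
    case 2
    then have "Wprod (Var :: _ \<Rightarrow> 'a vpoly) is $ r $ s \<in> R3 m" for r s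
      by (intro subalgebra_Wprod subalgebra_R3 Var_in_R3) auto
    then show ?thesis
      using 2 by (simp add: Tr_trace trace_2 subalgebraD[OF subalgebra_R3])
  qed
qed

lemma generated_polyfun:
  assumes "generated m F"
  shows "polyfun ({1..m} \<times> UNIV) F"
proof -
  obtain f where f: "f \<in> subalgebra hull gens m" "\<And>p. ev p f = F p"
    using assms unfolding generated_def by blast
  then have "f \<in> R3 m" using hull_minimal[where S = subalgebra, OF gens_subset_R3 subalgebra_R3] by blast
  then have "polyfun ({1..m} \<times> UNIV) (\<lambda>p. ev p f)" by (rule polyfun_ev)
  then show ?thesis by (simp add: f(2))
qed

text \<open>
  Keeping track of the multidegree \<open>\<alpha>\<close> ensures that an invariant is always matched with an element of
  the same degree, so that the descent below terminates.
\<close>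

definition generated_hom :: "nat \<Rightarrow> (nat \<Rightarrow> nat) \<Rightarrow> ((nat \<times> 3 \<Rightarrow> 'k::comm_ring_1) \<Rightarrow> 'k) \<Rightarrow> bool" where
  "generated_hom m \<alpha> F \<longleftrightarrow> generated m F \<and> (\<forall>i\<in>{1..m}. \<forall>t p. F (scale i t p) = t ^ \<alpha> i * F p)"

lemma generated_hom_add: "generated_hom m \<alpha> F \<Longrightarrow> generated_hom m \<alpha> G \<Longrightarrow> generated_hom m \<alpha> (\<lambda>p. F p + G p)"
  by (auto simp: generated_hom_def intro: generated_add) (simp add: distrib_left)

lemma generated_hom_mult:
  assumes "generated_hom m \<alpha> F" "generated_hom m \<beta> G" "\<And>i. i \<in> {1..m} \<Longrightarrow> \<gamma> i = \<alpha> i + \<beta> i"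
  shows "generated_hom m \<gamma> (\<lambda>p. F p * G p)"
  using assms by (auto simp: generated_hom_def power_add mult_ac intro!: generated_mult)

lemma generated_hom_const: "(\<And>i. i \<in> {1..m} \<Longrightarrow> \<alpha> i = 0) \<Longrightarrow> generated_hom m \<alpha> (\<lambda>p. c)"
  by (auto simp: generated_hom_def intro: generated_const)

lemma generated_hom_zero: "generated_hom m \<alpha> (\<lambda>p. 0)"
  by (auto simp: generated_hom_def intro: generated_const)

lemma qf_scale: "qf (scale l t p) i = (if l = i then t\<^sup>2 * qf p i else qf p i)"
  by (auto simp: qf_def scale_apply power2_eq_square algebra_simps)

lemma Wprod_scale: "Wprod (scale l t p) is $ r $ s = t ^ count_list is l * Wprod p is $ r $ s"
proof (induction "is" arbitrary: r s)
  case (Cons i "is")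
  have "Wmat (scale l t p) i $ r $ k = (if i = l then t else 1) * Wmat p i $ r $ k" for k
    using exhaust_2[of r] exhaust_2[of k] by (auto simp: scale_apply)
  then show ?case by (simp add: matrix_mult_2 Cons.IH algebra_simps)
qed simp

lemma generated_hom_qf: "j \<in> {1..m} \<Longrightarrow> generated_hom m (\<lambda>i. if i = j then 2 else 0) (\<lambda>p. qf p j)"
  by (auto simp: generated_hom_def qf_scale intro!: generated_qf)

lemma generated_hom_trace:
  assumes "CHAR('k::comm_ring_1) = 2" and "set is \<subseteq> {1..m}"
  shows "generated_hom m (count_list is) (\<lambda>p :: nat \<times> 3 \<Rightarrow> 'k. trace (Wprod p is))"
  using generated_trace[OF assms] by (auto simp: generated_hom_def trace_2 Wprod_scale distrib_left)

text \<open>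
  In characteristic \<open>2\<close> this parametrises the points with \<open>q(v\<^sub>i) = 0\<close> for all \<open>i\<close>.
\<close>

definition cone :: "(nat \<times> bool \<Rightarrow> 'k::comm_ring_1) \<Rightarrow> nat \<times> 3 \<Rightarrow> 'k" where
  "cone p = (\<lambda>(i, c). if c = 1 then (p (i, False))\<^sup>2 else if c = 2 then (p (i, True))\<^sup>2
     else p (i, False) * p (i, True))"

lemma cone_apply [simp]: "cone p (i, 1) = (p (i, False))\<^sup>2" "cone p (i, 2) = (p (i, True))\<^sup>2"
    "cone p (i, 3) = p (i, False) * p (i, True)"
  by (simp_all add: cone_def)

fun path_product :: "(nat \<times> bool \<Rightarrow> 'k::field) \<Rightarrow> nat list \<Rightarrow> 'k" where
  "path_product p (i # j # w) = bracket p i j * path_product p (j # w)"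
| "path_product p _ = 1"

lemma path_product_snoc: "w \<noteq> [] \<Longrightarrow> path_product p (w @ [k]) = path_product p w * bracket p (last w) k"
  by (induction p w rule: path_product.induct) auto

lemma bracket_commute:
  assumes "CHAR('k::field) = 2"
  shows "bracket (p :: nat \<times> bool \<Rightarrow> 'k) i j = bracket p j i"
  by (simp add: bracket_def char_2_simps[OF assms] algebra_simps)

text \<open>
  On the cone, \<open>V\<^sub>i\<close> is the column \<open>(a\<^sub>i, b\<^sub>i)\<close> times the row \<open>(b\<^sub>i, a\<^sub>i)\<close>. In characteristic \<open>2\<close> the
  row \<open>i\<close> times the column \<open>j\<close> is the bracket \<open>[i j]\<close>.
\<close>

lemma Wprod_cone:
  assumes ch: "CHAR('k::field) = 2"
  shows "Wprod (cone (p :: nat \<times> bool \<Rightarrow> 'k)) (i # w) $ r $ s =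
    (if r = 1 then p (i, False) else p (i, True)) * path_product p (i # w) *
    (if s = 1 then p (last (i # w), True) else p (last (i # w), False))"
proof (induction w arbitrary: i r)
  case Nil
  then show ?case
    using exhaust_2[of r] exhaust_2[of s] by (auto simp: matrix_mult_2 mat_def power2_eq_square)
next
  case (Cons j w)
  have bracket: "bracket p i j = p (i, True) * p (j, False) + p (i, False) * p (j, True)"
    by (simp add: bracket_def char_2_simps[OF ch] mult.commute add.commute)
  have "Wprod (cone p) (i # j # w) $ r $ s =
    (if r = 1 then p (i, False) else p (i, True)) *
    (p (i, True) * Wprod (cone p) (j # w) $ 1 $ s + p (i, False) * Wprod (cone p) (j # w) $ 2 $ s)"
    using exhaust_2[of r]
    by (subst Wprod_Cons, subst matrix_mult_2) (auto simp: power2_eq_square algebra_simps)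
  then show ?case
    unfolding Cons.IH by (simp add: bracket algebra_simps)
qed

lemma trace_cone:
  assumes ch: "CHAR('k::field) = 2" and "w \<noteq> []"
  shows "trace (Wprod (cone (p :: nat \<times> bool \<Rightarrow> 'k)) w) = path_product p (w @ [hd w])"
proof -
  obtain i v where w: "w = i # v" using assms(2) by (cases w) auto
  show ?thesis
    unfolding trace_2 path_product_snoc[OF assms(2)] unfolding w Wprod_cone[OF ch]
    by (simp add: bracket_def char_2_simps[OF ch] algebra_simps)
qed

lemma bracket_monomial_append: "bracket_monomial (es @ fs) p = bracket_monomial es p * bracket_monomial fs p"
  by (induction es) auto

lemma edge_degree_append: "edge_degree (es @ fs) l = edge_degree es l + edge_degree fs l"
  by (induction es) auto

lemma edge_degree_pos: "edge_degree es j > 0 \<Longrightarrow> \<exists>x y. (x, y) \<in> set es \<and> (x = j \<or> y = j)"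
  by (induction es) (fastforce split: if_splits)+

text \<open>
  Decomposition of a multigraph with even degrees into closed walks. The walk \<open>w\<close> under construction and
  the unused edges \<open>es\<close> satisfy a degree condition that says that the union of both is even, where an
  inner vertex of \<open>w\<close> counts twice and the two ends count once (so that a one-vertex walk contributes
  degree \<open>0\<close>). If \<open>w\<close> is not closed, parity provides an unused edge at its last vertex, and \<open>w\<close> is
  prolonged. If \<open>w\<close> is closed, it is split off as a trace. If it is a single vertex, it is restarted at
  any unused edge.
\<close>

lemma even_bracket_monomial_walk:
  assumes ch: "CHAR('k::field) = 2"
  shows "w \<noteq> [] \<Longrightarrow> set w \<subseteq> {1..m} \<Longrightarrow> set es \<subseteq> {1..m} \<times> {1..m} \<Longrightarrow>
    (\<And>l. l \<in> {1..m} \<Longrightarrow> edge_degree es l + 2 * count_list w l = 2 * \<alpha> l + of_bool (hd w = l) + of_bool (last w = l)) \<Longrightarrow>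
    \<exists>g. generated_hom m \<alpha> g \<and> (\<forall>p :: nat \<times> bool \<Rightarrow> 'k. g (cone p) = path_product p w * bracket_monomial es p)"
proof (induction "2 * length es + length w" arbitrary: w es \<alpha> rule: less_induct)
  case less
  note deg = less.prems(4)
  consider i where "w = [i]" | "tl w \<noteq> []" "hd w = last w" | "hd w \<noteq> last w"
    using less.prems(1) by (metis list.collapse)
  then show ?case
  proof cases
    case 1
    show ?thesis
    proof (cases es)
      case Nil
      have "\<alpha> l = 0" if "l \<in> {1..m}" for l using deg[OF that] by (simp add: 1 Nil split: if_splits)
      then have "generated_hom m \<alpha> (\<lambda>p. 1 :: 'k)" by (rule generated_hom_const)
      then show ?thesis by (intro exI[of _ "\<lambda>p. 1"]) (simp add: 1 Nil)
    next
      case (Cons e es')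
      obtain x y where e: "e = (x, y)" by force
      have "\<exists>g. generated_hom m \<alpha> g \<and> (\<forall>p :: nat \<times> bool \<Rightarrow> 'k. g (cone p) = path_product p [x, y] * bracket_monomial es' p)"
      proof (rule less.hyps)
        show "2 * length es' + length [x, y] < 2 * length es + length w" by (simp add: 1 Cons)
        show "edge_degree es' l + 2 * count_list [x, y] l = 2 * \<alpha> l + of_bool (hd [x, y] = l) + of_bool (last [x, y] = l)"
          if "l \<in> {1..m}" for l
          using deg[OF that] by (auto simp: 1 Cons e split: if_splits)
      qed (use less.prems(3) in \<open>auto simp: Cons e\<close>)
      then show ?thesis by (simp add: 1 Cons e)
    qed
  next
    case 2
    define v where "v = butlast w"
    have w: "w = v @ [hd v]" and v: "v \<noteq> []"
    proof -
      show "v \<noteq> []" using 2(1) by (cases w) (auto simp: v_def)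
      moreover have "w = v @ [last w]" unfolding v_def using less.prems(1) by simp
      moreover have "hd v = hd w" using calculation by (metis hd_append2)
      ultimately show "w = v @ [hd v]" using 2(2) by simp
    qed
    have set_v: "set v \<subseteq> {1..m}" using less.prems(2) by (simp add: w)
    have deg_v: "edge_degree es l + 2 * count_list v l = 2 * \<alpha> l" if "l \<in> {1..m}" for l
      using deg[OF that] v by (auto simp: w split: if_splits)
    have "\<exists>g. generated_hom m (\<lambda>l. \<alpha> l - count_list v l) g \<and> (\<forall>p :: nat \<times> bool \<Rightarrow> 'k. g (cone p) = path_product p [hd v] * bracket_monomial es p)"
    proof (rule less.hyps)
      show "2 * length es + length [hd v] < 2 * length es + length w" using v by (simp add: w)
      show "edge_degree es l + 2 * count_list [hd v] l =
        2 * (\<alpha> l - count_list v l) + of_bool (hd [hd v] = l) + of_bool (last [hd v] = l)" if "l \<in> {1..m}" for l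
        using deg_v[OF that] by auto
      show "set [hd v] \<subseteq> {1..m}" using set_v v by (simp add: subset_iff)
    qed (use less.prems(3) in auto)
    then obtain g where g: "generated_hom m (\<lambda>l. \<alpha> l - count_list v l) g"
      "\<forall>p :: nat \<times> bool \<Rightarrow> 'k. g (cone p) = bracket_monomial es p" by auto
    have "count_list v l \<le> \<alpha> l" if "l \<in> {1..m}" for l using deg_v[OF that] by linarith
    then have "generated_hom m \<alpha> (\<lambda>p. trace (Wprod p v) * g p)"
      by (intro generated_hom_mult[OF generated_hom_trace[OF ch set_v] g(1)]) simp
    moreover have "trace (Wprod (cone p) v) = path_product p w" for p :: "nat \<times> bool \<Rightarrow> 'k"
      using trace_cone[OF ch v, of p] w by simp
    ultimately show ?thesis using g(2) by (intro exI[of _ "\<lambda>p. trace (Wprod p v) * g p"]) simp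
  next
    case 3
    define j where "j = last w"
    have j: "j \<in> {1..m}" using less.prems(1,2) unfolding j_def by (meson last_in_set subsetD)
    have "edge_degree es j + 2 * count_list w j = 2 * \<alpha> j + 1"
      using deg[OF j] 3 by (simp add: j_def)
    then have "edge_degree es j > 0" by presburger
    then obtain x y where xy: "(x, y) \<in> set es" "x = j \<or> y = j" using edge_degree_pos by blast
    then obtain es1 es2 where es: "es = es1 @ (x, y) # es2" by (meson split_list)
    define k where "k = (if x = j then y else x)"
    have k: "k \<in> {1..m}" using xy less.prems(3) by (auto simp: k_def)
    have brk: "bracket p x y = bracket p j k" for p :: "nat \<times> bool \<Rightarrow> 'k"
      using xy(2) bracket_commute[OF ch] by (auto simp: k_def)
    have "\<exists>g. generated_hom m \<alpha> g \<and> (\<forall>p :: nat \<times> bool \<Rightarrow> 'k. g (cone p) = path_product p (w @ [k]) * bracket_monomial (es1 @ es2) p)"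
    proof (rule less.hyps)
      show "2 * length (es1 @ es2) + length (w @ [k]) < 2 * length es + length w" by (simp add: es)
      show "edge_degree (es1 @ es2) l + 2 * count_list (w @ [k]) l =
        2 * \<alpha> l + of_bool (hd (w @ [k]) = l) + of_bool (last (w @ [k]) = l)" if "l \<in> {1..m}" for l
      proof -
        have "edge_degree es l = edge_degree (es1 @ es2) l + of_bool (j = l) + of_bool (k = l)"
          using xy(2) by (auto simp: es edge_degree_append k_def)
        then show ?thesis using deg[OF that] less.prems(1)
          by (cases "hd w = l"; cases "k = l") (simp_all add: j_def)
      qed
    qed (use less.prems k es in auto)
    moreover have "path_product p (w @ [k]) * bracket_monomial (es1 @ es2) p = path_product p w * bracket_monomial es p" for p :: "nat \<times> bool \<Rightarrow> 'k"
      using less.prems(1) by (simp add: path_product_snoc es bracket_monomial_append brk j_def)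
    ultimately show ?thesis by simp
  qed
qed

lemma even_bracket_span_generated:
  assumes ch: "CHAR('k::field) = 2" and "m \<ge> 1" and "bracket_span (insert 0 {1..m}) \<beta> F" and "\<beta> 0 = 0"
    and "\<And>l. l \<in> {1..m} \<Longrightarrow> \<beta> l = 2 * \<alpha> l"
  shows "\<exists>g. generated_hom m \<alpha> g \<and> (\<forall>p :: nat \<times> bool \<Rightarrow> 'k. g (cone p) = F (pin p))"
  using assms(3)
proof (induction rule: bracket_span.induct)
  case zero
  show ?case using generated_hom_zero by auto
next
  case (step F es c)
  have edges: "set es \<subseteq> {1..m} \<times> {1..m}"
    using step.hyps(2) step.hyps(3)[of 0] assms(4)
  proof (induction es)
    case (Cons e es)
    then show ?case by (cases e) (auto split: if_splits)
  qed simp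
  have deg: "edge_degree es l + 2 * count_list [1] l = 2 * \<alpha> l + of_bool (hd [1] = l) + of_bool (last [1] = l)"
    if "l \<in> {1..m}" for l
    using step.hyps(3)[of l] assms(5)[OF that] that by auto
  have "\<exists>g. generated_hom m \<alpha> g \<and> (\<forall>p :: nat \<times> bool \<Rightarrow> 'k. g (cone p) = path_product p [1] * bracket_monomial es p)"
    by (rule even_bracket_monomial_walk[OF ch]) (use assms(2) edges deg in auto)
  then obtain g where g: "generated_hom m \<alpha> g" "\<And>p :: nat \<times> bool \<Rightarrow> 'k. g (cone p) = bracket_monomial es p" by auto
  from step.IH obtain f where f: "generated_hom m \<alpha> f" "\<And>p :: nat \<times> bool \<Rightarrow> 'k. f (cone p) = F (pin p)" by blast
  have pin: "bracket_monomial es (pin p) = bracket_monomial es p" for p :: "nat \<times> bool \<Rightarrow> 'k"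
    using edges
  proof (induction es)
    case (Cons e es)
    then show ?case by (cases e) (auto simp: bracket_def pin_def)
  qed simp
  have "generated_hom m \<alpha> (\<lambda>p. f p + c * g p)"
    by (intro generated_hom_add f(1) generated_hom_mult[OF generated_hom_const[of m "\<lambda>_. 0"] g(1)]) auto
  then show ?case by (intro exI[of _ "\<lambda>p. f p + c * g p"]) (simp add: f(2) g(2) pin)
qed

section \<open>Descent along the quadrics\<close>

text \<open>
  The conditions are imposed only on the first \<open>j\<close> vectors, to be released one after the other.
\<close>

definition cones :: "nat \<Rightarrow> (nat \<times> 3 \<Rightarrow> 'k::comm_ring_1) \<Rightarrow> bool" where
  "cones j p \<longleftrightarrow> (\<forall>i\<in>{1..j}. qf p i = 0)"

definition inv_on_cones :: "nat \<Rightarrow> ((nat \<times> 3 \<Rightarrow> 'k::field) \<Rightarrow> 'k) \<Rightarrow> bool" where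
  "inv_on_cones j F \<longleftrightarrow> (\<forall>p. \<forall>A\<in>O3. cones j p \<longrightarrow> F (act A p) = F p)"

definition hom_on_cones :: "nat \<Rightarrow> nat \<Rightarrow> (nat \<Rightarrow> nat) \<Rightarrow> ((nat \<times> 3 \<Rightarrow> 'k::field) \<Rightarrow> 'k) \<Rightarrow> bool" where
  "hom_on_cones m j \<alpha> F \<longleftrightarrow> (\<forall>p t. \<forall>i\<in>{1..m}. cones j p \<longrightarrow> F (scale i t p) = t ^ \<alpha> i * F p)"

text \<open>
  Invariant multihomogeneous functions on the locus \<open>cones j\<close> lift to the generated algebra, with their
  degree. For \<open>j = 0\<close> the locus is the whole space, and this is the fundamental theorem for
  multihomogeneous invariants; larger \<open>j\<close> are the stages of its proof.
\<close>

definition restriction_onto :: "'k::field itself \<Rightarrow> nat \<Rightarrow> nat \<Rightarrow> bool" where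
  "restriction_onto TYPE('k) m j \<longleftrightarrow> (\<forall>\<alpha> (F :: (nat \<times> 3 \<Rightarrow> 'k) \<Rightarrow> 'k).
     polyfun ({1..m} \<times> UNIV) F \<longrightarrow> inv_on_cones j F \<longrightarrow> hom_on_cones m j \<alpha> F \<longrightarrow>
     (\<exists>g. generated_hom m \<alpha> g \<and> (\<forall>p. cones j p \<longrightarrow> F p = g p)))"

lemma cones_act: "A \<in> O3 \<Longrightarrow> cones j (act A p) \<longleftrightarrow> cones j p"
  by (simp add: cones_def qf_act)

lemma cones_scale: "cones j p \<Longrightarrow> cones j (scale i t p)"
  by (simp add: cones_def qf_scale)

lemma generated_act:
  fixes A :: "'k::alg_closed_field ^ 3 ^ 3"
  assumes ch: "CHAR('k) = 2" and "generated m F" and A: "A \<in> O3"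
  shows "F (act A p) = F p"
proof -
  obtain f where f: "f \<in> subalgebra hull gens m" "\<And>p. ev p f = F p"
    using assms(2) unfolding generated_def by blast
  have "ev (act A p) f = ev p f" for p
    using f(1)
  proof (rule hull_induct)
    fix h :: "'k vpoly" assume "h \<in> gens m"
    then show "ev (act A p) h = ev p h"
      by (auto simp: gens_def ev_Q ev_Tr qf_act[OF A] trace_act[OF ch A])
  next
    show "subalgebra {f. ev (act A p) f = ev p f}"
      by (auto simp: subalgebra_def ev_hom)
  qed
  then show ?thesis by (simp flip: f(2))
qed

text \<open>
  Pulled back along \<open>cone\<close>, the function \<open>F\<close> becomes a function of plane vectors. The shears and the
  torus of \<open>SL\<^sub>2\<close> lift to elements of \<open>O(3)\<close>, and scaling a plane vector by \<open>t\<close> scales its image by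
  \<open>t\<^sup>2\<close>; this makes all degrees even.
\<close>

lemma restriction_onto_all_cones:
  assumes ch: "CHAR('k::alg_closed_field) = 2" and m: "m \<ge> 1"
  shows "restriction_onto TYPE('k) m m"
  unfolding restriction_onto_def
proof (intro allI impI)
  fix \<alpha> and F :: "(nat \<times> 3 \<Rightarrow> 'k) \<Rightarrow> 'k"
  assume F: "polyfun ({1..m} \<times> UNIV) F" and inv: "inv_on_cones m F" and hom: "hom_on_cones m m \<alpha> F"
  note c2 = char_2_simps[OF ch]
  define h where "h p = F (cone p)" for p
  define \<beta> where "\<beta> l = (if l = 0 then 0 else 2 * \<alpha> l)" for l
  have cones_cone: "cones m (cone p)" for p :: "nat \<times> bool \<Rightarrow> 'k"
    by (simp add: cones_def qf_def power2_eq_square c2 mult_ac)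
  have "polyfun ({1..m} \<times> UNIV) h"
    unfolding h_def
  proof (rule polyfun_compose[OF F])
    fix u :: "nat \<times> 3" assume u: "u \<in> {1..m} \<times> UNIV"
    obtain i c where "u = (i, c)" by force
    with u show "polyfun ({1..m} \<times> UNIV) (\<lambda>p :: nat \<times> bool \<Rightarrow> 'k. cone p u)"
      using exhaust_3[of c] by (auto simp: power2_eq_square intro!: polyfun.mult polyfun.coord)
  qed
  moreover have "h (shear t p) = h p" for t p
  proof -
    define A :: "'k ^ 3 ^ 3" where "A = vector [vector [1, 0, 0], vector [t\<^sup>2, 1, 0], vector [t, 0, 1]]"
    have A: "A $ 1 $ 1 = 1" "A $ 1 $ 2 = 0" "A $ 1 $ 3 = 0" "A $ 2 $ 1 = t\<^sup>2" "A $ 2 $ 2 = 1" "A $ 2 $ 3 = 0"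
      "A $ 3 $ 1 = t" "A $ 3 $ 2 = 0" "A $ 3 $ 3 = 1"
      by (simp_all add: A_def)
    have "A ** A = mat 1"
      by (simp add: vec_eq_iff forall_3 matrix_matrix_mult_def sum_3 A mat_def c2)
    moreover have "qform (A *v v) = qform v" for v
      by (simp add: qform_def matrix_vector_mult_def sum_3 A power2_eq_square algebra_simps c2)
    ultimately have "A \<in> O3" by (auto simp: O3_def invertible_def)
    moreover have "cone (shear t p) = act A (cone p)"
    proof
      fix u :: "nat \<times> 3"
      obtain i c where u: "u = (i, c)" by force
      show "cone (shear t p) u = act A (cone p) u"
        using exhaust_3[of c]
        by (auto simp: u act_apply A shear_def power2_eq_square algebra_simps c2)
    qed
    ultimately show ?thesis
      using inv cones_cone unfolding h_def inv_on_cones_def by simp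
  qed
  moreover have "h (torus s p) = s ^ \<beta> 0 * h p" if "s \<noteq> 0" for s p
  proof -
    define r where "r = inverse s"
    have rs: "r * s = 1" "s * r = 1" using that by (simp_all add: r_def)
    have rs2: "r\<^sup>2 * s\<^sup>2 = 1" "s\<^sup>2 * r\<^sup>2 = 1" using rs by (simp_all flip: power_mult_distrib)
    define A B :: "'k ^ 3 ^ 3"
      where "A = vector [vector [s\<^sup>2, 0, 0], vector [0, r\<^sup>2, 0], vector [0, 0, 1]]"
        and "B = vector [vector [r\<^sup>2, 0, 0], vector [0, s\<^sup>2, 0], vector [0, 0, 1]]"
    have A: "A $ 1 $ 1 = s\<^sup>2" "A $ 1 $ 2 = 0" "A $ 1 $ 3 = 0" "A $ 2 $ 1 = 0" "A $ 2 $ 2 = r\<^sup>2" "A $ 2 $ 3 = 0"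
      "A $ 3 $ 1 = 0" "A $ 3 $ 2 = 0" "A $ 3 $ 3 = 1"
      by (simp_all add: A_def)
    have B: "B $ 1 $ 1 = r\<^sup>2" "B $ 1 $ 2 = 0" "B $ 1 $ 3 = 0" "B $ 2 $ 1 = 0" "B $ 2 $ 2 = s\<^sup>2" "B $ 2 $ 3 = 0"
      "B $ 3 $ 1 = 0" "B $ 3 $ 2 = 0" "B $ 3 $ 3 = 1"
      by (simp_all add: B_def)
    have "A ** B = mat 1" "B ** A = mat 1"
      by (simp_all add: vec_eq_iff forall_3 matrix_matrix_mult_def sum_3 A B mat_def rs2)
    moreover have "qform (A *v v) = qform v" for v
    proof -
      have "(s\<^sup>2 * v $ 1) * (r\<^sup>2 * v $ 2) = (s\<^sup>2 * r\<^sup>2) * (v $ 1 * v $ 2)" by (simp only: mult_ac)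
      then show ?thesis
        by (simp add: qform_def matrix_vector_mult_def sum_3 A rs2)
    qed
    ultimately have "A \<in> O3" by (auto simp: O3_def invertible_def)
    moreover have "cone (torus s p) = act A (cone p)"
    proof
      fix u :: "nat \<times> 3"
      obtain i c where u: "u = (i, c)" by force
      have "(s * p (i, False)) * (r * p (i, True)) = (s * r) * (p (i, False) * p (i, True))"
        by (simp only: mult_ac)
      then show "cone (torus s p) u = act A (cone p) u"
        using exhaust_3[of c]
        by (auto simp: u act_apply A torus_def power_mult_distrib rs simp flip: r_def)
    qed
    ultimately show ?thesis
      using inv cones_cone unfolding h_def inv_on_cones_def by (simp add: \<beta>_def)
  qed
  moreover have "h (scale i t p) = t ^ \<beta> i * h p" if "i \<in> {1..m}" for i t p
  proof -
    have "cone (scale i t p) = scale i (t\<^sup>2) (cone p)"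
      by (auto simp: cone_def scale_def power2_eq_square mult_ac)
    then show ?thesis
      using hom cones_cone that unfolding h_def hom_on_cones_def
      by (auto simp: \<beta>_def power_mult)
  qed
  ultimately obtain G where G: "bracket_span (insert 0 {1..m}) \<beta> G" "\<And>p. h p = G (pin p)"
    using covariants_bracket_span[OF infinite_alg_closed_field, of "{1..m}" h \<beta>] by auto
  obtain g where g: "generated_hom m \<alpha> g" "\<And>p :: nat \<times> bool \<Rightarrow> 'k. g (cone p) = G (pin p)"
    using even_bracket_span_generated[OF ch m G(1), of \<alpha>] by (auto simp: \<beta>_def)
  have "F p = g p" if p: "cones m p" for p
  proof -
    define r :: "nat \<times> bool \<Rightarrow> 'k"
      where "r = (\<lambda>(i, c). SOME y. y\<^sup>2 = (if c then p (i, 2) else p (i, 1)))"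
    have r: "(r (i, False))\<^sup>2 = p (i, 1)" "(r (i, True))\<^sup>2 = p (i, 2)" for i
      using someI_ex[OF exists_sqrt[of "p (i, 1)"]] someI_ex[OF exists_sqrt[of "p (i, 2)"]]
      by (simp_all add: r_def)
    have "cone r (i, c) = p (i, c)" if "i \<in> {1..m}" for i c
    proof -
      have "p (i, 1) * p (i, 2) + (p (i, 3))\<^sup>2 = 0" using p that by (simp add: cones_def qf_def)
      then have "(p (i, 3))\<^sup>2 = (r (i, False) * r (i, True))\<^sup>2"
        using c2(4) by (metis add_eq_0_iff r power_mult_distrib)
      then have "p (i, 3) = r (i, False) * r (i, True)" by (rule square_inj_char_2[OF ch])
      then show ?thesis using exhaust_3[of c] r by auto
    qed
    then have eq: "p u = cone r u" if "u \<in> {1..m} \<times> UNIV" for u using that by auto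
    have "F p = F (cone r)" by (rule polyfun_cong[OF F eq])
    also have "\<dots> = g (cone r)" using G(2) g(2) by (simp add: h_def)
    also have "\<dots> = g p"
      using polyfun_cong[OF generated_polyfun[of m g] eq] g(1) by (simp add: generated_hom_def)
    finally show ?thesis .
  qed
  with g(1) show "\<exists>g. generated_hom m \<alpha> g \<and> (\<forall>p. cones m p \<longrightarrow> F p = g p)" by blast
qed

text \<open>
  Division with remainder by \<open>q(v\<^sub>i)\<close>, which is monic of degree two in \<open>z\<close>: in characteristic \<open>2\<close>,
  \<open>z\<^sup>2\<close> may be replaced by \<open>q(v\<^sub>i) + x y\<close>.
\<close>

lemma polyfun_divide_qf:
  assumes ch: "CHAR('k::field) = 2"
  shows "polyfun V F \<Longrightarrow> {i} \<times> UNIV \<subseteq> V \<Longrightarrow> \<exists>H r\<^sub>0 r\<^sub>1. polyfun V H \<and>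
     polyfun (V - {(i, 3)}) r\<^sub>0 \<and> polyfun (V - {(i, 3)}) r\<^sub>1 \<and>
     (\<forall>p :: nat \<times> 3 \<Rightarrow> 'k. F p = qf p i * H p + r\<^sub>0 p + r\<^sub>1 p * p (i, 3))"
proof (induction rule: polyfun.induct)
  case (const c)
  show ?case
    by (intro exI[of _ "\<lambda>_. 0"] exI[of _ "\<lambda>_. c"]) (auto intro: polyfun.const)
next
  case (coord u)
  show ?case
  proof (cases "u = (i, 3)")
    case True
    then show ?thesis
      by (intro exI[of _ "\<lambda>_. 0"] exI[of _ "\<lambda>_. 1"]) (auto intro: polyfun.const)
  next
    case False
    then show ?thesis using coord
      by (intro exI[of _ "\<lambda>_. 0"] exI[of _ "\<lambda>p. p u"]) (auto intro: polyfun.const polyfun.coord)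
  qed
next
  case (add F G)
  from add.IH(1)[OF add.prems] obtain H r0 r1 where H: "polyfun V H" "polyfun (V - {(i, 3)}) r0" "polyfun (V - {(i, 3)}) r1"
     "\<forall>p :: nat \<times> 3 \<Rightarrow> 'k. F p = qf p i * H p + r0 p + r1 p * p (i, 3)" by blast
  from add.IH(2)[OF add.prems] obtain K s0 s1 where K: "polyfun V K" "polyfun (V - {(i, 3)}) s0" "polyfun (V - {(i, 3)}) s1"
     "\<forall>p :: nat \<times> 3 \<Rightarrow> 'k. G p = qf p i * K p + s0 p + s1 p * p (i, 3)" by blast
  show ?case
    by (intro exI[of _ "\<lambda>p. H p + K p"] exI[of _ "\<lambda>p. r0 p + s0 p"] exI[of _ "\<lambda>p. r1 p + s1 p"]
      conjI polyfun.add H(1-3) K(1-3)) (simp add: H(4) K(4) algebra_simps)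
next
  case (mult F G)
  from mult.IH(1)[OF mult.prems] obtain H r0 r1 where H: "polyfun V H" "polyfun (V - {(i, 3)}) r0" "polyfun (V - {(i, 3)}) r1"
     "\<forall>p :: nat \<times> 3 \<Rightarrow> 'k. F p = qf p i * H p + r0 p + r1 p * p (i, 3)" by blast
  from mult.IH(2)[OF mult.prems] obtain K s0 s1 where K: "polyfun V K" "polyfun (V - {(i, 3)}) s0" "polyfun (V - {(i, 3)}) s1"
     "\<forall>p :: nat \<times> 3 \<Rightarrow> 'k. G p = qf p i * K p + s0 p + s1 p * p (i, 3)" by blast
  have coords: "polyfun V (\<lambda>p :: nat \<times> 3 \<Rightarrow> 'k. p (i, c))" for c
    using mult.prems by (intro polyfun.coord) auto
  have coords': "polyfun (V - {(i, 3)}) (\<lambda>p :: nat \<times> 3 \<Rightarrow> 'k. p (i, 1))"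
    "polyfun (V - {(i, 3)}) (\<lambda>p :: nat \<times> 3 \<Rightarrow> 'k. p (i, 2))"
    using mult.prems by (auto intro!: polyfun.coord)
  have up: "polyfun V f" if "polyfun (V - {(i, 3)}) f" for f :: "(nat \<times> 3 \<Rightarrow> 'k) \<Rightarrow> 'k"
    using that by (rule polyfun_mono) auto
  define L where "L p = H p * G p + (r0 p + r1 p * p (i, 3)) * K p + r1 p * s1 p" for p
  have "polyfun V L" unfolding L_def
    by (intro polyfun.add polyfun.mult H(1) K(1) mult.hyps up H(2,3) K(2,3) coords)
  moreover have "polyfun (V - {(i, 3)}) (\<lambda>p. r0 p * s0 p + r1 p * s1 p * (p (i, 1) * p (i, 2)))"
    by (intro polyfun.add polyfun.mult H(2,3) K(2,3) coords')
  moreover have "polyfun (V - {(i, 3)}) (\<lambda>p. r0 p * s1 p + r1 p * s0 p)"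
    by (intro polyfun.add polyfun.mult H(2,3) K(2,3))
  moreover have "F p * G p = qf p i * L p + (r0 p * s0 p + r1 p * s1 p * (p (i, 1) * p (i, 2))) +
    (r0 p * s1 p + r1 p * s0 p) * p (i, 3)" for p
  proof -
    define x y z where "x = p (i, 1)" and "y = p (i, 2)" and "z = p (i, 3)"
    define q where "q = qf p i"
    have zz: "z * z = q + x * y"
      by (simp add: q_def qf_def x_def y_def z_def power2_eq_square char_2_simps[OF ch] add.commute)
    have "F p * G p = q * (H p * G p) + q * ((r0 p + r1 p * z) * K p) + (r0 p + r1 p * z) * (s0 p + s1 p * z)"
      by (simp add: H(4) K(4) q_def z_def algebra_simps)
    also have "(r0 p + r1 p * z) * (s0 p + s1 p * z) = r0 p * s0 p + (r0 p * s1 p + r1 p * s0 p) * z + r1 p * s1 p * (z * z)"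
      by (simp add: algebra_simps)
    finally show ?thesis
      unfolding zz by (simp add: L_def algebra_simps flip: q_def x_def y_def z_def)
  qed
  ultimately show ?case by blast
qed

text \<open>
  The degrees of the two sides have different parity unless both vanish.
\<close>

lemma square_eq_odd_square:
  fixes P R :: "'a::idom poly"
  assumes "P\<^sup>2 = [:0, c:] * R\<^sup>2"
  shows "P = 0 \<and> (c = 0 \<or> R = 0)"
proof -
  have "c = 0 \<or> R = 0"
  proof (rule ccontr)
    assume *: "\<not> (c = 0 \<or> R = 0)"
    then have "degree ([:0, c:] * R\<^sup>2) = Suc (2 * degree R)"
      by (subst degree_mult_eq) (auto simp: degree_power_eq)
    moreover have "degree (P\<^sup>2) = 2 * degree P"
      by (cases "P = 0") (auto simp: degree_power_eq)
    ultimately have "2 * degree P = Suc (2 * degree R)" using assms by simp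
    then show False by presburger
  qed
  moreover from this have "P\<^sup>2 = 0" using assms by auto
  ultimately show ?thesis by simp
qed

lemma cones_upd: "j < i \<Longrightarrow> cones j (p((i, c) := t)) \<longleftrightarrow> cones j p"
  by (auto simp: cones_def qf_def)

lemma cones_Suc: "cones (Suc j) p \<longleftrightarrow> cones j p \<and> qf p (Suc j) = 0"
  by (auto simp: cones_def atLeastAtMostSuc_conv)

text \<open>
  The remainder \<open>r\<^sub>0 + r\<^sub>1 z\<close> vanishes on the quadric \<open>q(v\<^sub>i) = 0\<close>, where \<open>z\<^sup>2 = x y\<close>. Squaring gives
  \<open>r\<^sub>0\<^sup>2 = x y r\<^sub>1\<^sup>2\<close> for all \<open>x\<close>, an equation between polynomials in \<open>x\<close> that is impossible for reasons
  of parity unless \<open>r\<^sub>0 = 0\<close>, and \<open>r\<^sub>1 = 0\<close> or \<open>y = 0\<close>; the case \<open>y = 0\<close> follows by density.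
\<close>

lemma divide_qf_on_cones:
  assumes ch: "CHAR('k::alg_closed_field) = 2"
    and F: "polyfun ({1..m} \<times> UNIV) F" and i: "Suc j \<in> {1..m}"
    and zero: "\<And>p :: nat \<times> 3 \<Rightarrow> 'k. cones (Suc j) p \<Longrightarrow> F p = 0"
  shows "\<exists>H. polyfun ({1..m} \<times> UNIV) H \<and> (\<forall>p. cones j p \<longrightarrow> F p = qf p (Suc j) * H p)"
proof -
  note inf = infinite_alg_closed_field[where 'k = 'k]
  define i where "i = Suc j"
  define V :: "(nat \<times> 3) set" where "V = {1..m} \<times> UNIV"
  have "{i} \<times> UNIV \<subseteq> V" using i by (auto simp: i_def V_def)
  then obtain H r0 r1 where H: "polyfun V H" "polyfun (V - {(i, 3)}) r0" "polyfun (V - {(i, 3)}) r1"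
    "\<And>p. F p = qf p i * H p + r0 p + r1 p * p (i, 3)"
    using polyfun_divide_qf[OF ch F[folded V_def]] by blast
  have remainder: "r0 p = 0 \<and> (p (i, 2) = 0 \<or> r1 p = 0)" if p: "cones j p" for p
  proof -
    obtain b where b: "b\<^sup>2 = p (i, 2)" using exists_sqrt[of "p (i, 2)"] by blast
    obtain P where P: "\<And>t. r0 (p((i, 1) := t)) = poly P t"
      using polyfun_along_line[OF H(2)] by metis
    obtain R where R: "\<And>t. r1 (p((i, 1) := t)) = poly R t"
      using polyfun_along_line[OF H(3)] by metis
    have "P\<^sup>2 = [:0, p (i, 2):] * R\<^sup>2"
    proof (rule poly_eq_if_agree[OF inf])
      fix x :: 'k
      obtain t where t: "t\<^sup>2 = x" using exists_sqrt[of x] by blast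
      define p' where "p' = p((i, 1) := x, (i, 3) := t * b)"
      have "cones (Suc j) p'"
        using p t b by (simp add: cones_Suc p'_def cones_upd i_def qf_def power_mult_distrib char_2_simps[OF ch])
      then have "F p' = 0" "qf p' i = 0" using zero by (auto simp: cones_Suc i_def)
      then have "r0 p' + r1 p' * (t * b) = 0"
        using H(4)[of p'] by (simp add: p'_def)
      moreover have "r0 p' = poly P x" "r1 p' = poly R x"
        using polyfun_cong[OF H(2), of p' "p((i, 1) := x)"] polyfun_cong[OF H(3), of p' "p((i, 1) := x)"] P R
        by (auto simp: p'_def)
      ultimately have "poly P x = poly R x * (t * b)"
        using char_2_simps(4)[OF ch] by (metis add_eq_0_iff)
      then have "(poly P x)\<^sup>2 = (poly R x)\<^sup>2 * (x * p (i, 2))"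
        by (simp add: power_mult_distrib t b)
      then show "poly (P\<^sup>2) x = poly ([:0, p (i, 2):] * R\<^sup>2) x"
        by (simp add: algebra_simps)
    qed
    then have "P = 0 \<and> (p (i, 2) = 0 \<or> R = 0)" by (rule square_eq_odd_square)
    then show ?thesis using P[of "p (i, 1)"] R[of "p (i, 1)"] by auto
  qed
  have r1: "r1 p = 0" if p: "cones j p" for p
  proof (rule polyfun_zero_by_density[OF inf H(3)])
    show "polyfun UNIV (\<lambda>p :: nat \<times> 3 \<Rightarrow> 'k. p (i, 2))" by (intro polyfun.coord) simp
    show "(p((i, 2) := t)) (i, 2) * r1 (p((i, 2) := t)) = 0" for t
      using remainder[of "p((i, 2) := t)"] p by (auto simp: cones_upd i_def)
    show "(p((i, 2) := 1)) (i, 2) \<noteq> 0" by simp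
  qed
  have "F p = qf p i * H p" if "cones j p" for p
    using H(4)[of p] remainder[OF that] r1[OF that] by simp
  then show ?thesis using H(1) unfolding i_def V_def by blast
qed

text \<open>
  The locus \<open>cones j\<close> does not restrict the next vector, so that vector's coordinate \<open>z\<close> can be moved
  until \<open>q\<close> of the vector is nonzero.
\<close>

lemma zero_on_cones_by_density:
  fixes F :: "(nat \<times> 3 \<Rightarrow> 'k::alg_closed_field) \<Rightarrow> 'k"
  assumes ch: "CHAR('k) = 2" and F: "polyfun V F" and p: "cones j p"
    and zero: "\<And>p. cones j p \<Longrightarrow> qf p (Suc j) * F p = 0"
  shows "F p = 0"
proof -
  note c2 = char_2_simps[OF ch]
  obtain s where s: "s\<^sup>2 = p (Suc j, 1) * p (Suc j, 2)"
    using exists_sqrt[of "p (Suc j, 1) * p (Suc j, 2)"] by blast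
  show ?thesis
  proof (rule polyfun_zero_by_density[OF infinite_alg_closed_field F])
    show "polyfun UNIV (\<lambda>p :: nat \<times> 3 \<Rightarrow> 'k. qf p (Suc j))"
      unfolding qf_def by (intro polyfun.add polyfun.mult polyfun_power polyfun.coord) simp_all
    show "qf (p((Suc j, 3) := t)) (Suc j) * F (p((Suc j, 3) := t)) = 0" for t
      using p by (intro zero) (simp add: cones_upd)
    \<comment> \<open>The value is \<open>x y + (s + 1)\<^sup>2 = 1\<close>.\<close>
    show "qf (p((Suc j, 3) := s + 1)) (Suc j) \<noteq> 0"
      by (simp add: qf_def power2_sum c2 s)
  qed
qed

text \<open>
  If \<open>g\<close> agrees with \<open>F\<close> where moreover \<open>q(v\<^sub>i) = 0\<close>, then \<open>F - g = q(v\<^sub>i) H\<close>. By density \<open>H\<close> inherits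
  invariance and homogeneity, with degree smaller by \<open>2\<close> in \<open>v\<^sub>i\<close>, so \<open>H\<close> is covered by induction on
  this degree. In degrees \<open>0\<close> and \<open>1\<close> the function \<open>H\<close> vanishes on the locus.
\<close>

lemma restriction_onto_step:
  assumes ch: "CHAR('k::alg_closed_field) = 2" and j: "j < m" and lift: "restriction_onto TYPE('k) m (Suc j)"
  shows "restriction_onto TYPE('k) m j"
proof -
  note inf = infinite_alg_closed_field[where 'k = 'k]
  define i where "i = Suc j"
  have i: "i \<in> {1..m}" using j by (simp add: i_def)
  have "\<exists>g. generated_hom m \<alpha> g \<and> (\<forall>p. cones j p \<longrightarrow> F p = g p)"
    if "polyfun ({1..m} \<times> UNIV) F" "inv_on_cones j F" "hom_on_cones m j \<alpha> F"
    for \<alpha> and F :: "(nat \<times> 3 \<Rightarrow> 'k) \<Rightarrow> 'k"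
    using that
  proof (induction "\<alpha> i" arbitrary: \<alpha> F rule: less_induct)
    case (less \<alpha> F)
    have "inv_on_cones (Suc j) F" "hom_on_cones m (Suc j) \<alpha> F"
      using less.prems(2,3) by (auto simp: inv_on_cones_def hom_on_cones_def cones_Suc)
    then obtain g where g: "generated_hom m \<alpha> g" "\<And>p. cones (Suc j) p \<Longrightarrow> F p = g p"
      using lift less.prems(1) unfolding restriction_onto_def by blast
    have gen_g: "generated m g" using g(1) by (simp add: generated_hom_def)
    define D where "D p = F p - g p" for p
    have D: "polyfun ({1..m} \<times> UNIV) D"
      unfolding D_def by (intro polyfun_diff less.prems(1) generated_polyfun gen_g)
    have D_act: "D (act A p) = D p" if "cones j p" "A \<in> O3" for A p
      using less.prems(2) that generated_act[OF ch gen_g] by (simp add: D_def inv_on_cones_def)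
    have D_scale: "D (scale l t p) = t ^ \<alpha> l * D p" if "cones j p" "l \<in> {1..m}" for l t p
      using less.prems(3) that g(1) by (simp add: D_def hom_on_cones_def generated_hom_def right_diff_distrib)
    have "\<exists>H. polyfun ({1..m} \<times> UNIV) H \<and> (\<forall>p. cones j p \<longrightarrow> D p = qf p i * H p)"
      unfolding i_def by (rule divide_qf_on_cones[OF ch D]) (use i g(2) in \<open>auto simp: D_def i_def\<close>)
    then obtain H where H: "polyfun ({1..m} \<times> UNIV) H" "\<And>p. cones j p \<Longrightarrow> D p = qf p i * H p"
      by blast
    have cancel: "E p = 0" if "polyfun W E" "cones j p" "\<And>p. cones j p \<Longrightarrow> qf p i * E p = 0"
      for W E and p :: "nat \<times> 3 \<Rightarrow> 'k"
      using zero_on_cones_by_density[OF ch that(1,2)] that(3) by (simp add: i_def)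
    have H_act: "H (act A p) = H p" if p: "cones j p" and A: "A \<in> O3" for A p
    proof -
      have "polyfun ({1..m} \<times> UNIV) (\<lambda>p. H (act A p) - H p)"
        by (intro polyfun_diff polyfun_act[OF H(1)] H(1))
      moreover have "qf p i * (H (act A p) - H p) = 0" if "cones j p" for p
        using D_act[OF that A] H(2)[OF that] H(2)[of "act A p"] that A
        by (simp add: cones_act qf_act right_diff_distrib)
      ultimately have "H (act A p) - H p = 0" by (rule cancel[OF _ p])
      then show ?thesis by simp
    qed
    have H_scale: "H (scale l t p) = t ^ \<alpha> l * H p" if p: "cones j p" and l: "l \<in> {1..m}" "l \<noteq> i" for l t p
    proof -
      have "polyfun ({1..m} \<times> UNIV) (\<lambda>p. H (scale l t p) - t ^ \<alpha> l * H p)"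
        by (intro polyfun_diff polyfun.mult polyfun.const polyfun_scale[OF H(1)] H(1))
      moreover have "qf p i * (H (scale l t p) - t ^ \<alpha> l * H p) = 0" if "cones j p" for p
        using D_scale[OF that l(1), of t] H(2)[OF that] H(2)[of "scale l t p"] that l(2)
        by (simp add: cones_scale qf_scale right_diff_distrib mult.left_commute)
      ultimately have "H (scale l t p) - t ^ \<alpha> l * H p = 0" by (rule cancel[OF _ p])
      then show ?thesis by simp
    qed
    have H_scale_i: "t\<^sup>2 * H (scale i t p) = t ^ \<alpha> i * H p" if p: "cones j p" for t p
    proof -
      have "polyfun ({1..m} \<times> UNIV) (\<lambda>p. t\<^sup>2 * H (scale i t p) - t ^ \<alpha> i * H p)"
        by (intro polyfun_diff polyfun.mult polyfun.const polyfun_scale[OF H(1)] H(1))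
      moreover have "qf p i * (t\<^sup>2 * H (scale i t p) - t ^ \<alpha> i * H p) = 0" if "cones j p" for p
        using D_scale[OF that i, of t] H(2)[OF that] H(2)[of "scale i t p"] that
        by (simp add: cones_scale qf_scale right_diff_distrib mult.left_commute mult.assoc)
      ultimately have "t\<^sup>2 * H (scale i t p) - t ^ \<alpha> i * H p = 0" by (rule cancel[OF _ p])
      then show ?thesis by simp
    qed
    show ?case
    proof (cases "\<alpha> i < 2")
      case True
      have "H p = 0" if p: "cones j p" for p
      proof -
        obtain P where P: "\<And>t. H (scale i t p) = poly P t"
          using polyfun_along_scaling[OF H(1)] unfolding scale_as_scaling by metis
        have "monom 1 2 * P = monom (H p) (\<alpha> i)"
          using H_scale_i[OF p]
          by (intro poly_eq_if_agree[OF inf]) (simp add: poly_monom P mult.commute)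
        then have "coeff (monom 1 2 * P) (\<alpha> i) = H p" by simp
        then show ?thesis using True by (simp add: coeff_monom_mult)
      qed
      then have "F p = g p" if "cones j p" for p
        using H(2)[OF that] that by (simp add: D_def)
      then show ?thesis using g(1) by blast
    next
      case False
      define \<gamma> where "\<gamma> = \<alpha>(i := \<alpha> i - 2)"
      have "\<exists>g. generated_hom m \<gamma> g \<and> (\<forall>p. cones j p \<longrightarrow> H p = g p)"
      proof (rule less.hyps)
        show "\<gamma> i < \<alpha> i" using False by (simp add: \<gamma>_def)
        show "inv_on_cones j H" using H_act by (simp add: inv_on_cones_def)
        have "H (scale i t p) = t ^ \<gamma> i * H p" if p: "cones j p" for t p
        proof (rule polyfun_homogeneous_at_zero[OF inf H(1)])
          fix t :: 'k assume "t \<noteq> 0"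
          moreover have "t ^ \<alpha> i = t\<^sup>2 * t ^ \<gamma> i"
          proof -
            have "\<alpha> i = 2 + \<gamma> i" using False by (simp add: \<gamma>_def)
            then show ?thesis by (simp only: power_add)
          qed
          ultimately show "H (scale i t p) = t ^ \<gamma> i * H p"
            using H_scale_i[OF p, of t] by (simp add: mult.assoc)
        qed
        then show "hom_on_cones m j \<gamma> H"
          using H_scale by (auto simp: hom_on_cones_def \<gamma>_def)
      qed (rule H(1))
      then obtain g' where g': "generated_hom m \<gamma> g'" "\<And>p. cones j p \<Longrightarrow> H p = g' p" by blast
      have "generated_hom m \<alpha> (\<lambda>p. g p + qf p i * g' p)"
        by (intro generated_hom_add g(1) generated_hom_mult[OF generated_hom_qf[OF i] g'(1)]) (use False in \<open>auto simp: \<gamma>_def\<close>)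
      moreover have "F p = g p + qf p i * g' p" if "cones j p" for p
        using H(2)[OF that] g'(2)[OF that] by (simp add: D_def algebra_simps)
      ultimately show ?thesis by blast
    qed
  qed
  then show ?thesis unfolding restriction_onto_def by blast
qed

lemma restriction_onto_no_cones:
  assumes ch: "CHAR('k::alg_closed_field) = 2" and m: "m \<ge> 1"
  shows "restriction_onto TYPE('k) m 0"
proof -
  have "restriction_onto TYPE('k) m j" if "j \<le> m" for j
    using that by (induction rule: inc_induct) (auto intro: restriction_onto_all_cones[OF ch m] restriction_onto_step[OF ch])
  then show ?thesis by simp
qed

lemma generated_sum: "(\<And>e. e \<in> A \<Longrightarrow> generated m (F e)) \<Longrightarrow> generated m (\<lambda>p. \<Sum>e\<in>A. F e p)"
  by (induction A rule: infinite_finite_induct) (auto intro: generated_const generated_add)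

text \<open>
  An invariant need not be homogeneous. Its homogeneous components in one vector are invariant, because
  the group action commutes with scaling this vector; likewise they keep the homogeneity in the vectors
  already treated. Splitting with respect to each vector in turn leads to multihomogeneous invariants.
\<close>

lemma invariant_generated:
  fixes F :: "(nat \<times> 3 \<Rightarrow> 'k::alg_closed_field) \<Rightarrow> 'k"
  assumes ch: "CHAR('k) = 2" and m: "m \<ge> 1"
    and F: "polyfun ({1..m} \<times> UNIV) F" and inv: "\<And>A p. A \<in> O3 \<Longrightarrow> F (act A p) = F p"
  shows "generated m F"
proof -
  note inf = infinite_alg_closed_field[where 'k = 'k]
  have "generated m F"
    if "polyfun ({1..m} \<times> UNIV) F" "\<And>A p. A \<in> O3 \<Longrightarrow> F (act A p) = F p"
      "\<And>i t p. i \<in> {n<..m} \<Longrightarrow> F (scale i t p) = t ^ \<alpha> i * F p"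
    for n \<alpha> and F :: "(nat \<times> 3 \<Rightarrow> 'k) \<Rightarrow> 'k"
    using that
  proof (induction n arbitrary: \<alpha> F)
    case 0
    have "inv_on_cones 0 F" "hom_on_cones m 0 \<alpha> F"
      using 0 by (auto simp: inv_on_cones_def hom_on_cones_def)
    then have "\<exists>g. generated_hom m \<alpha> g \<and> (\<forall>p. cones 0 p \<longrightarrow> F p = g p)"
      using restriction_onto_no_cones[OF ch m] 0(1) unfolding restriction_onto_def by blast
    then obtain g where "generated_hom m \<alpha> g" "\<And>p. F p = g p"
      by (auto simp: cones_def)
    then show ?case by (auto simp: generated_hom_def dest: ext)
  next
    case (Suc n)
    define i where "i = Suc n"
    obtain P N where P: "\<And>p t. F (scale i t p) = poly (P p) t"
      "\<And>e. polyfun ({1..m} \<times> UNIV) (\<lambda>p. coeff (P p) e)" "\<And>p. degree (P p) \<le> N"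
      using polyfun_homogeneous_components[OF Suc.prems(1), of i] by blast
    have commuting: "coeff (P (T p)) e = c * coeff (P p) e"
      if "\<And>p. F (T p) = c * F p" "\<And>t p. T (scale i t p) = scale i t (T p)" for T c e p
    proof -
      have "P (T p) = smult c (P p)"
        by (rule poly_eq_if_agree[OF inf]) (simp add: P(1)[symmetric] that flip: that(2))
      then show ?thesis by simp
    qed
    have "generated m (\<lambda>p. coeff (P p) e)" for e
    proof (rule Suc.IH[where \<alpha> = "\<alpha>(i := e)"])
      show "polyfun ({1..m} \<times> UNIV) (\<lambda>p. coeff (P p) e)" by (rule P(2))
      show "coeff (P (act A p)) e = coeff (P p) e" if "A \<in> O3" for A p
        using commuting[of "act A" 1] Suc.prems(2)[OF that] by (simp add: scale_act)
      show "coeff (P (scale l t p)) e = t ^ (\<alpha>(i := e)) l * coeff (P p) e" if "l \<in> {n<..m}" for l t p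
      proof (cases "l = i")
        case True
        have "P (scale i t p) = pcompose (P p) [:0, t:]"
          by (rule poly_eq_if_agree[OF inf])
            (simp add: P(1)[symmetric] scale_scale poly_pcompose mult.commute)
        then show ?thesis using True by (simp add: coeff_pcompose_linear)
      next
        case False
        then show ?thesis
          using commuting[of "scale l t" "t ^ \<alpha> l"] Suc.prems(3)[of l] that
          by (simp add: scale_commute[of l] i_def)
      qed
    qed
    then have "generated m (\<lambda>p. \<Sum>e\<le>N. coeff (P p) e)"
      by (intro generated_sum)
    moreover have "F p = (\<Sum>e\<le>N. coeff (P p) e)" for p
    proof -
      have "F p = poly (P p) 1" using P(1)[of 1 p] by (simp add: scale_1)
      also have "\<dots> = (\<Sum>e\<le>degree (P p). coeff (P p) e)" by (simp add: poly_altdef)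
      also have "\<dots> = (\<Sum>e\<le>N. coeff (P p) e)"
        using P(3)[of p] by (intro sum.mono_neutral_left) (auto simp: coeff_eq_0)
      finally show ?thesis .
    qed
    ultimately show ?case by (simp add: fun_eq_iff[symmetric])
  qed
  from this[of F m] F inv show ?thesis by simp
qed

lemma O3_invariants_hull:
  assumes ch: "CHAR('k::alg_closed_field) = 2" and m: "m \<ge> 1"
  shows "subalgebra hull gens m = (O3_invariants m :: 'k vpoly set)"
proof
  note inf = infinite_alg_closed_field[where 'k = 'k]
  show "subalgebra hull gens m \<subseteq> (O3_invariants m :: 'k vpoly set)"
  proof
    fix f :: "'k vpoly" assume f: "f \<in> subalgebra hull gens m"
    then have "f \<in> R3 m"
      using hull_minimal[where S = subalgebra, OF gens_subset_R3 subalgebra_R3] by blast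
    moreover have "pullback A f = f" if A: "A \<in> O3" for A
    proof (rule ev_inject[OF inf])
      have "generated m (\<lambda>p. ev p f)" using f unfolding generated_def by blast
      then show "ev p (pullback A f) = ev p f" for p
        using generated_act[OF ch _ A] by (simp add: ev_pullback)
    qed
    ultimately show "f \<in> O3_invariants m" by (simp add: O3_invariants_def)
  qed
  show "(O3_invariants m :: 'k vpoly set) \<subseteq> subalgebra hull gens m"
  proof
    fix f :: "'k vpoly" assume "f \<in> O3_invariants m"
    then have f: "f \<in> R3 m" "\<And>A. A \<in> O3 \<Longrightarrow> pullback A f = f" by (auto simp: O3_invariants_def)
    have "generated m (\<lambda>p. ev p f)"
      by (rule invariant_generated[OF ch m polyfun_ev[OF f(1)]]) (metis ev_pullback f(2))
    then obtain g where "g \<in> subalgebra hull gens m" "\<And>p. ev p g = ev p f"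
      unfolding generated_def by blast
    moreover from this(2) have "g = f" by (rule ev_inject[OF inf])
    ultimately show "f \<in> subalgebra hull gens m" by simp
  qed
qed

section \<open>Minimality\<close>

lemma Wprod_zero:
  assumes "i \<in> set is" and "\<And>c. p (i, c) = 0"
  shows "Wprod p is $ r $ s = 0"
  using assms(1)
proof (induction "is" arbitrary: r s)
  case (Cons j "is")
  show ?case
  proof (cases "j = i")
    case True
    then have "Wmat p j $ r $ k = 0" for k
      using exhaust_2[of r] exhaust_2[of k] assms(2) by auto
    then show ?thesis by (simp add: matrix_mult_2)
  next
    case False
    then show ?thesis using Cons by (simp add: matrix_mult_2)
  qed
qed simp

text \<open>
  At points where all vectors except \<open>v\<^sub>j\<close> vanish, all other generators vanish, and the algebra generated
  by them consists of constants, while \<open>Q\<^sup>(\<^sup>j\<^sup>)\<close> takes the values \<open>0\<close> and \<open>1\<close>.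
\<close>

lemma Q_indecomposable:
  fixes H :: "'k::comm_ring_1 vpoly set"
  assumes H: "H \<subseteq> gens m" "Q j \<notin> H"
  shows "Q j \<notin> subalgebra hull H"
proof
  assume Q: "Q j \<in> subalgebra hull H"
  define T where "T = {p :: nat \<times> 3 \<Rightarrow> 'k. \<forall>i c. i \<noteq> j \<longrightarrow> p (i, c) = 0}"
  define S where "S = {f :: 'k vpoly. \<exists>c. \<forall>p\<in>T. ev p f = c}"
  have "H \<subseteq> S"
  proof
    fix h assume "h \<in> H"
    with H have "h \<in> gens m" "h \<noteq> Q j" by auto
    then consider i where "h = Q i" "i \<noteq> j" | "is" where "h = Tr is" "2 \<le> length is" "sorted_wrt (<) is"
      by (auto simp: gens_def)
    then show "h \<in> S"
    proof cases
      case 1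
      then show ?thesis by (auto simp: S_def T_def ev_Q qf_def)
    next
      case 2
      have "distinct is" using 2(3) by (simp add: strict_sorted_iff)
      then have "\<not> set is \<subseteq> {j}"
        using 2(2) card_mono[of "{j}" "set is"] by (auto simp: distinct_card)
      then obtain i where "i \<in> set is" "i \<noteq> j" by blast
      then show ?thesis by (auto simp: 2(1) S_def T_def ev_Tr trace_2 Wprod_zero[where i = i])
    qed
  qed
  moreover have "subalgebra S"
    unfolding subalgebra_def
  proof (intro conjI ballI)
    show "range Const \<subseteq> S" by (auto simp: S_def)
    fix f g assume "f \<in> S" "g \<in> S"
    then obtain c d where "\<forall>p\<in>T. ev p f = c" "\<forall>p\<in>T. ev p g = d" unfolding S_def by blast
    then have "\<forall>p\<in>T. ev p (f + g) = c + d" "\<forall>p\<in>T. ev p (f * g) = c * d"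
      by (simp_all add: ev_hom)
    then show "f + g \<in> S" "f * g \<in> S" unfolding S_def by blast+
  qed
  ultimately have "subalgebra hull H \<subseteq> S" by (rule hull_minimal)
  with Q obtain c where c: "\<And>p. p \<in> T \<Longrightarrow> ev p (Q j) = c" unfolding S_def by blast
  have "(\<lambda>u. if u = (j, 3) then 1 else 0) \<in> T" "(\<lambda>_. 0) \<in> T" by (auto simp: T_def)
  from c[OF this(1)] c[OF this(2)] show False
    by (simp add: ev_Q qf_def)
qed

definition z_exponents :: "nat list \<Rightarrow> nat \<times> 3 \<Rightarrow>\<^sub>0 nat" where
  "z_exponents is = sum_list (map (\<lambda>i. Poly_Mapping.single (i, 3) 1) is)"

lemma lookup_z_exponents: "Poly_Mapping.lookup (z_exponents is) (l, c) = (if c = 3 then count_list is l else 0)"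
  by (induction "is") (auto simp: z_exponents_def lookup_add lookup_single when_def)

lemma prod_list_Var:
  "prod_list (map (\<lambda>i. Var (i, 3)) is) = (Poly_Mapping.single (z_exponents is) 1 :: 'k::comm_ring_1 vpoly)"
  by (induction "is") (auto simp: z_exponents_def Var_def mult_single)

lemma Wprod_scalar:
  assumes "\<And>i. i \<in> set is \<Longrightarrow> p (i, 1) = 0 \<and> p (i, 2) = 0"
  shows "Wprod p is $ r $ s = (if r = s then prod_list (map (\<lambda>i. p (i, 3)) is) else 0)"
  using assms
proof (induction "is" arbitrary: r)
  case Nil
  then show ?case by (simp add: mat_def)
next
  case (Cons i "is")
  then have "Wmat p i $ r $ k = (if r = k then p (i, 3) else 0)" for k
    using exhaust_2[of r] exhaust_2[of k] by auto
  then show ?case using Cons exhaust_2[of r] by (auto simp: matrix_mult_2)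
qed

text \<open>
  A subalgebra that detects one squarefree monomial \<open>s\<close>: all nonconstant squarefree monomials of its
  elements contain the variable \<open>\<xi>\<close>, and \<open>s\<close> is not among them. It is closed under products because a
  product of two nonconstant monomials that both contain \<open>\<xi>\<close> is not squarefree.
\<close>

definition no_monomial :: "nat \<times> 3 \<Rightarrow> (nat \<times> 3 \<Rightarrow>\<^sub>0 nat) \<Rightarrow> 'k::comm_ring_1 vpoly set" where
  "no_monomial \<xi> s = {f. \<forall>t \<in> Poly_Mapping.keys f. (\<forall>u. Poly_Mapping.lookup t u \<le> 1) \<longrightarrow>
     t = 0 \<or> Poly_Mapping.lookup t \<xi> = 1 \<and> t \<noteq> s}"

lemma subalgebra_no_monomial: "subalgebra (no_monomial \<xi> s)"
proof -
  have "range Const \<subseteq> no_monomial \<xi> s"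
    by (auto simp: no_monomial_def Const_def split: if_splits)
  moreover have "f + g \<in> no_monomial \<xi> s" if "f \<in> no_monomial \<xi> s" "g \<in> no_monomial \<xi> s" for f g :: "'a vpoly"
    using that Poly_Mapping.keys_add[of f g] by (fastforce simp: no_monomial_def)
  moreover have "f * g \<in> no_monomial \<xi> s" if fg: "f \<in> no_monomial \<xi> s" "g \<in> no_monomial \<xi> s" for f g :: "'a vpoly"
    unfolding no_monomial_def
  proof (intro CollectI ballI impI)
    fix t assume t: "t \<in> Poly_Mapping.keys (f * g)" and sq: "\<forall>u. Poly_Mapping.lookup t u \<le> 1"
    obtain a b where ab: "t = a + b" "a \<in> Poly_Mapping.keys f" "b \<in> Poly_Mapping.keys g"
      using keys_mult[of f g] t by blast
    have "Poly_Mapping.lookup a u \<le> 1 \<and> Poly_Mapping.lookup b u \<le> 1" for u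
      using sq[rule_format, of u] by (simp add: ab(1) lookup_add)
    then have "a = 0 \<or> Poly_Mapping.lookup a \<xi> = 1 \<and> a \<noteq> s" "b = 0 \<or> Poly_Mapping.lookup b \<xi> = 1 \<and> b \<noteq> s"
      using fg ab(2,3) by (auto simp: no_monomial_def)
    moreover have "\<not> (Poly_Mapping.lookup a \<xi> = 1 \<and> Poly_Mapping.lookup b \<xi> = 1)"
      using sq[rule_format, of \<xi>] by (auto simp: ab(1) lookup_add)
    ultimately show "t = 0 \<or> Poly_Mapping.lookup t \<xi> = 1 \<and> t \<noteq> s"
      by (auto simp: ab(1) lookup_add)
  qed
  ultimately show ?thesis by (auto simp: subalgebra_def)
qed

text \<open>
  Let \<open>a\<close> and \<open>b\<close> be the first two letters of the word and \<open>w\<close> the rest. Specialise \<open>v\<^sub>a = (x, 0, 0)\<close>,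
  \<open>v\<^sub>b = (0, y, 0)\<close>, \<open>v\<^sub>i = (0, 0, z\<^sub>i)\<close> for \<open>i\<close> in \<open>w\<close>, and the other vectors to \<open>0\<close>. The matrices become
  two opposite matrix units and scalar matrices. Therefore \<open>Q\<^sup>(\<^sup>i\<^sup>)\<close> becomes \<open>0\<close> or \<open>z\<^sub>i\<^sup>2\<close>, and the trace of
  an increasing word becomes \<open>0\<close> unless the word is \<open>a, b, v\<close> with \<open>v\<close> a subword of \<open>w\<close>, when it becomes
  the monomial \<open>x y \<Prod> z\<^sub>i\<close>. The monomial with \<open>v = w\<close> is the one to be detected.
\<close>

lemma Tr_indecomposable:
  fixes H :: "'k::comm_ring_1 vpoly set"
  assumes ch: "CHAR('k) = 2" and H: "H \<subseteq> gens m" "Tr js \<notin> H"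
    and js: "2 \<le> length js" "sorted_wrt (<) js"
  shows "Tr js \<notin> subalgebra hull H"
proof
  assume Tr: "Tr js \<in> subalgebra hull H"
  obtain a b w where abw: "js = a # b # w"
    using js(1) by (cases js; cases "tl js") auto
  have dist: "a \<noteq> b" "a \<notin> set w" "b \<notin> set w" "distinct w"
    using js(2) by (auto simp: abw strict_sorted_iff)
  define \<sigma> :: "nat \<times> 3 \<Rightarrow> 'k vpoly" where
    "\<sigma> = (\<lambda>(i, c). if i = a \<and> c = 1 \<or> i = b \<and> c = 2 \<or> i \<in> set w \<and> c = 3 then Var (i, c) else 0)"
  define expo where "expo v = Poly_Mapping.single (a, 1) 1 + Poly_Mapping.single (b, 2) 1 + z_exponents v" for v
  have lookup_expo: "Poly_Mapping.lookup (expo v) (l, c) = of_bool (l = a \<and> c = 1) + of_bool (l = b \<and> c = 2) +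
    (if c = 3 then count_list v l else 0)" for v l c
    by (auto simp: expo_def lookup_add lookup_z_exponents lookup_single when_def)
  have sa: "\<sigma> (a, 1) = Var (a, 1)" "\<sigma> (a, 2) = 0" "\<sigma> (a, 3) = 0"
    and sb: "\<sigma> (b, 1) = 0" "\<sigma> (b, 2) = Var (b, 2)" "\<sigma> (b, 3) = 0"
    using dist by (auto simp: \<sigma>_def)
  have sw: "\<sigma> (i, 1) = 0" "\<sigma> (i, 2) = 0" "\<sigma> (i, 3) = Var (i, 3)" if "i \<in> set w" for i
    using dist that by (auto simp: \<sigma>_def)
  have double: "x + x = 0" for x :: "'k vpoly"
  proof -
    have "(1 + 1 :: 'k vpoly) = Const (1 + 1)" by (simp add: Const_def single_add)
    also have "\<dots> = 0" using char_2_simps(2)[OF ch, of 1] by (simp add: Const_def)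
    finally have "(1 + 1) * x = 0" by simp
    then show ?thesis by (simp only: distrib_right mult_1)
  qed
  have trace_full: "trace (Wprod \<sigma> (a # b # v)) = Poly_Mapping.single (expo v) 1" if "set v \<subseteq> set w" for v
  proof -
    have v: "Wprod \<sigma> v $ r $ s = (if r = s then Poly_Mapping.single (z_exponents v) 1 else 0)" for r s
    proof -
      have "map (\<lambda>i. \<sigma> (i, 3)) v = map (\<lambda>i. Var (i, 3)) v" using that sw by (intro map_cong) auto
      moreover have "Wprod \<sigma> v $ r $ s = (if r = s then prod_list (map (\<lambda>i. \<sigma> (i, 3)) v) else 0)"
        using that sw by (intro Wprod_scalar) auto
      ultimately show ?thesis by (simp only: prod_list_Var)
    qed
    show ?thesis
      by (simp add: trace_2 matrix_mult_2 sa sb v expo_def Var_def mult_single add.assoc)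
  qed
  have trace_sub: "trace (Wprod \<sigma> ks) = 0 \<or> (\<exists>v. ks = a # b # v \<and> set v \<subseteq> set w)"
    if ks: "sorted_wrt (<) ks" for ks
  proof (cases "set ks \<subseteq> set js")
    case False
    then obtain i where "i \<in> set ks" "i \<notin> set js" by blast
    then have "Wprod \<sigma> ks $ r $ s = 0" for r s
      by (intro Wprod_zero[of i]) (auto simp: \<sigma>_def abw)
    then show ?thesis by (simp add: trace_2)
  next
    case True
    define v where "v = filter (\<lambda>i. i \<in> set ks) w"
    have v: "set v \<subseteq> set w" by (auto simp: v_def)
    have "ks = filter (\<lambda>i. i \<in> set ks) js"
    proof (rule strict_sorted_equal)
      show "sorted_wrt (<) (filter (\<lambda>i. i \<in> set ks) js)" using js(2) by (rule sorted_wrt_filter)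
      show "set ks = set (filter (\<lambda>i. i \<in> set ks) js)" using True by auto
    qed (rule ks)
    then have ks_eq: "ks = (if a \<in> set ks then [a] else []) @ (if b \<in> set ks then [b] else []) @ v"
      by (simp add: abw v_def split: if_splits)
    have scalar: "Wprod \<sigma> v $ r $ s = (if r = s then prod_list (map (\<lambda>i. \<sigma> (i, 3)) v) else 0)" for r s
      using v sw by (intro Wprod_scalar) auto
    consider "ks = v" | "ks = a # v" | "ks = b # v" | "ks = a # b # v"
      using ks_eq by (auto split: if_splits)
    then show ?thesis
    proof cases
      case 1
      then show ?thesis by (simp add: trace_2 scalar double)
    next
      case 2
      then show ?thesis by (simp add: trace_2 matrix_mult_2 scalar sa)
    next
      case 3
      then show ?thesis by (simp add: trace_2 matrix_mult_2 scalar sb)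
    next
      case 4
      then show ?thesis using v by blast
    qed
  qed
  define S where "S = {f. vsubst \<sigma> f \<in> no_monomial (a, 1) (expo w)}"
  have "H \<subseteq> S"
  proof
    fix h assume "h \<in> H"
    with H have "h \<in> gens m" "h \<noteq> Tr js" by auto
    then consider i where "h = Q i" | ks where "h = Tr ks" "sorted_wrt (<) ks" "ks \<noteq> js"
      by (auto simp: gens_def)
    then show "h \<in> S"
    proof cases
      case 1
      have "\<sigma> (i, 1) * \<sigma> (i, 2) = 0" using dist by (auto simp: \<sigma>_def)
      then have "vsubst \<sigma> h = (\<sigma> (i, 3))\<^sup>2" by (simp add: 1 vsubst_Q qf_def)
      also have "\<dots> = (if i \<in> set w then Poly_Mapping.single (Poly_Mapping.single (i, 3) (Suc (Suc 0))) 1 else 0)"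
        by (auto simp: \<sigma>_def Var_def power2_eq_square mult_single simp flip: single_add)
      finally have sq: "vsubst \<sigma> h = \<dots>" .
      show ?thesis
        unfolding S_def no_monomial_def mem_Collect_eq
      proof (intro ballI impI)
        fix t
        assume "t \<in> Poly_Mapping.keys (vsubst \<sigma> h)" and "\<forall>u. Poly_Mapping.lookup t u \<le> 1"
        then have "t = Poly_Mapping.single (i, 3) (Suc (Suc 0))" "Poly_Mapping.lookup t (i, 3) \<le> 1"
          by (auto simp: sq split: if_splits)
        then show "t = 0 \<or> Poly_Mapping.lookup t (a, 1) = 1 \<and> t \<noteq> expo w" by simp
      qed
    next
      case 2
      show ?thesis
      proof (cases "trace (Wprod \<sigma> ks) = 0")
        case True
        then show ?thesis by (simp add: S_def 2(1) vsubst_Tr no_monomial_def)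
      next
        case False
        then obtain v where v: "ks = a # b # v" "set v \<subseteq> set w" using trace_sub[OF 2(2)] by blast
        have "set v \<noteq> set w"
        proof
          assume "set v = set w"
          then have "set ks = set js" by (simp add: v(1) abw)
          then have "ks = js" using 2(2) js(2) by (intro strict_sorted_equal) auto
          with 2(3) show False ..
        qed
        then obtain i where i: "i \<in> set w" "i \<notin> set v" using v(2) by blast
        then have "Poly_Mapping.lookup (expo v) (i, 3) \<noteq> Poly_Mapping.lookup (expo w) (i, 3)"
          by (simp add: lookup_expo count_list_0_iff)
        then have "expo v \<noteq> expo w" by auto
        moreover have "Poly_Mapping.lookup (expo v) (a, 1) = 1" using dist by (simp add: lookup_expo)
        ultimately show ?thesis
          using trace_full[OF v(2)] by (simp add: S_def 2(1) vsubst_Tr v(1) no_monomial_def)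
      qed
    qed
  qed
  moreover have "subalgebra S"
    using subalgebra_no_monomial[of "(a, 1)" "expo w"]
    by (auto simp: subalgebra_def S_def vsubst_hom)
  ultimately have "subalgebra hull H \<subseteq> S" by (rule hull_minimal)
  with Tr have "Poly_Mapping.single (expo w) 1 \<in> (no_monomial (a, 1) (expo w) :: 'k vpoly set)"
    using trace_full[of w] by (auto simp: S_def abw vsubst_Tr)
  moreover have "Poly_Mapping.lookup (expo w) u \<le> 1" for u
  proof (cases u)
    case (Pair l c)
    have "count_list w l \<le> 1" using dist(4) by (induction w) auto
    then show ?thesis using dist(1) by (auto simp: Pair lookup_expo)
  qed
  moreover have "expo w \<noteq> 0"
    using lookup_expo[of w a 1] dist by auto
  ultimately show False by (simp add: no_monomial_def)
qed

theorem theorem2p4: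
  fixes m :: nat
  assumes "CHAR('k::alg_closed_field) = 2" and "m \<ge> 1"
  shows "minimal_generating_set
           ({Q j | j. 1 \<le> j \<and> j \<le> m} \<union>
            {Tr is | is. 2 \<le> length is \<and> length is \<le> m \<and> set is \<subseteq> {1..m} \<and> sorted_wrt (<) is})
           (O3_invariants m :: 'k vpoly set)"
  unfolding gens_def[symmetric] minimal_generating_set_def
proof (intro conjI allI impI)
  show hull: "subalgebra hull gens m = (O3_invariants m :: 'k vpoly set)"
    by (rule O3_invariants_hull[OF assms])
  fix H :: "'k vpoly set" assume H: "H \<subset> gens m"
  then obtain g where g: "g \<in> gens m" "g \<notin> H" by blast
  have "g \<notin> subalgebra hull H"
    using g H Q_indecomposable[of H m] Tr_indecomposable[OF assms(1), of H m] by (auto simp: gens_def)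
  moreover have "g \<in> subalgebra hull gens m" using g(1) by (rule hull_inc)
  ultimately show "subalgebra hull H \<noteq> O3_invariants m" using hull by blast
qed

end
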